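(* Let $G$ and $H$ be finite digraphs, let $k\ge 2$, and for each $x\in V(G)$ let $L(x)\subseteq V(H)$ be a list. Suppose $h$ is a minority homomorphism of $G\times H^k$ to $H$ consistent with the lists $L$. Then the existence of an $L$-homomorphism of $G$ to $H$ can be decided in polynomial time.
   Context: For a digraph $D$, $V(D)$ is its vertex set and $A(D)$ its arc set; $uv$ denotes the arc $(u,v)$. A function $h$ assigning to each $x\in V(G)$ and each $k$-tuple $a_1,\dots,a_k\in L(x)$ a vertex $h(x;a_1,\dots,a_k)\in V(H)$ is a homomorphism of $G\times H^k$ to $H$ consistent with $L$ if: (List property) $h(x;a_1,\dots,a_k)\in L(x)$ for all $x$ and $a_1,\dots,a_k\in L(x)$; (Adjacency property) for all $x,y\in V(G)$ with $xy\in A(G)$, all $a_1,\dots,a_k\in L(x)$ and $b_1,\dots,b_k\in L(y)$ with $a_ib_i\in A(H)$ for all $i$, we have $h(x;a_1,\dots,a_k)h(y;b_1,\dots,b_k)\in A(H)$. It is a minority homomorphism if moreover, for every $x\in V(G)$ and all $a,b\in L(x)$ (including $a=b$), $h(x;b,\dots,b,a)=h(x;b,\dots,b,a,b)=\dots=h(x;a,b,\dots,b)=a$, i.e. whenever all coordinates but one equal $b$ and the remaining one equals $a$, the value is $a$. An $L$-homomorphism of $G$ to $H$ is a map $g:V(G)\to V(H)$ with $g(x)\in L(x)$ for all $x$ and $g(x)g(y)\in A(H)$ whenever $xy\in A(G)$. The input of the decision problem is $G$ together with the lists $L$ (and $h$). *)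

theory Defs
  imports "Graph_Theory.Pair_Digraph" "HOL-Computational_Algebra.Polynomial"
begin

section \<open>Lists, homomorphisms and minority homomorphisms\<close>

text \<open>
  Digraphs are arc relations on a vertex set; loops are allowed.  A \<open>k\<close>-tuple is a list of
  length \<open>k\<close>, and the value at \<open>(x; a\<^sub>1, ..., a\<^sub>k)\<close> is \<open>h x [a\<^sub>1, ..., a\<^sub>k]\<close>.  All conditions
  concern only \<open>x \<in> V(G)\<close> and tuples over \<open>L x\<close>, so values of \<open>L\<close>, \<open>h\<close> and \<open>g\<close> elsewhere are
  irrelevant.
\<close>

definition list_assignment ::
  "'a pair_pre_digraph \<Rightarrow> 'b pair_pre_digraph \<Rightarrow> ('a \<Rightarrow> 'b set) \<Rightarrow> bool" where
  "list_assignment G H L \<longleftrightarrow> (\<forall>x \<in> pverts G. L x \<subseteq> pverts H)"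

definition list_homomorphism ::
  "'a pair_pre_digraph \<Rightarrow> 'b pair_pre_digraph \<Rightarrow> ('a \<Rightarrow> 'b set) \<Rightarrow> ('a \<Rightarrow> 'b) \<Rightarrow> bool" where
  "list_homomorphism G H L g \<longleftrightarrow>
     (\<forall>x \<in> pverts G. g x \<in> L x) \<and>
     (\<forall>x y. (x, y) \<in> parcs G \<longrightarrow> (g x, g y) \<in> parcs H)"

definition tuples :: "nat \<Rightarrow> 'b set \<Rightarrow> 'b list set" where
  "tuples k S = {as. length as = k \<and> set as \<subseteq> S}"

definition consistent_homomorphism ::
  "nat \<Rightarrow> 'a pair_pre_digraph \<Rightarrow> 'b pair_pre_digraph \<Rightarrow> ('a \<Rightarrow> 'b set) \<Rightarrow>
   ('a \<Rightarrow> 'b list \<Rightarrow> 'b) \<Rightarrow> bool" where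
  "consistent_homomorphism k G H L h \<longleftrightarrow>
     (\<forall>x \<in> pverts G. \<forall>as \<in> tuples k (L x). h x as \<in> L x) \<and>
     (\<forall>x y. (x, y) \<in> parcs G \<longrightarrow>
        (\<forall>as \<in> tuples k (L x). \<forall>bs \<in> tuples k (L y).
           (\<forall>i < k. (as ! i, bs ! i) \<in> parcs H) \<longrightarrow> (h x as, h y bs) \<in> parcs H))"

definition minority_homomorphism ::
  "nat \<Rightarrow> 'a pair_pre_digraph \<Rightarrow> 'b pair_pre_digraph \<Rightarrow> ('a \<Rightarrow> 'b set) \<Rightarrow>
   ('a \<Rightarrow> 'b list \<Rightarrow> 'b) \<Rightarrow> bool" where
  "minority_homomorphism k G H L h \<longleftrightarrow>
     consistent_homomorphism k G H L h \<and>
     (\<forall>x \<in> pverts G. \<forall>a \<in> L x. \<forall>b \<in> L x. \<forall>i < k. h x ((replicate k b)[i := a]) = a)"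


section \<open>Polynomial time\<close>

text \<open>
  The model of computation is first-order LISP: mutually recursive, call-by-value programs over
  binary trees, where every evaluation step (variable access, \<open>nil\<close>, \<open>cons\<close>, \<open>hd\<close>, \<open>tl\<close>,
  test for \<open>nil\<close>, binding, call) costs one unit.  With values represented by pointers into
  shared memory every step takes constant time for a fixed program, and in particular no step
  compares or copies whole trees.  Hence a run of cost \<open>n\<close> is simulated by a Turing machine in
  time polynomial in \<open>n\<close> and the input size.  Conversely, a Turing machine step is simulated in
  constant cost by keeping each tape as a pair of stacks.  So polynomial time in this model is
  the usual polynomial time; compare the languages over binary trees in N. D. Jones,
  Computability and Complexity from a Programming Perspective (MIT Press, 1997).
\<close>

datatype data = Dnil | Dcons data data

fun dhd :: "data \<Rightarrow> data" where
  "dhd Dnil = Dnil"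
| "dhd (Dcons u v) = u"

fun dtl :: "data \<Rightarrow> data" where
  "dtl Dnil = Dnil"
| "dtl (Dcons u v) = v"

text \<open>
  Variables are positions in the list of currently bound values; \<open>Bind\<close> pushes a value to the
  front, and the body of a called function sees exactly the list of its arguments.
\<close>

datatype expr =
    Var nat
  | NilE
  | ConsE expr expr
  | HdE expr
  | TlE expr
  | IfE expr expr expr
  | Bind expr expr
  | Call nat "expr list"

text \<open>A program is a list of function bodies; \<open>Call f es\<close> calls the function at position \<open>f\<close>.\<close>

type_synonym program = "expr list"

inductive eval :: "program \<Rightarrow> data list \<Rightarrow> expr \<Rightarrow> data \<Rightarrow> nat \<Rightarrow> bool"
  and evals :: "program \<Rightarrow> data list \<Rightarrow> expr list \<Rightarrow> data list \<Rightarrow> nat \<Rightarrow> bool"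
  for P :: program where
  eval_Var: "i < length \<rho> \<Longrightarrow> eval P \<rho> (Var i) (\<rho> ! i) 1"
| eval_Nil: "eval P \<rho> NilE Dnil 1"
| eval_Cons: "eval P \<rho> e u m \<Longrightarrow> eval P \<rho> e' v n \<Longrightarrow> eval P \<rho> (ConsE e e') (Dcons u v) (m + n + 1)"
| eval_Hd: "eval P \<rho> e v n \<Longrightarrow> eval P \<rho> (HdE e) (dhd v) (n + 1)"
| eval_Tl: "eval P \<rho> e v n \<Longrightarrow> eval P \<rho> (TlE e) (dtl v) (n + 1)"
| eval_If_true: "eval P \<rho> b u m \<Longrightarrow> u \<noteq> Dnil \<Longrightarrow> eval P \<rho> e v n \<Longrightarrow>
    eval P \<rho> (IfE b e e') v (m + n + 1)"
| eval_If_false: "eval P \<rho> b Dnil m \<Longrightarrow> eval P \<rho> e' v n \<Longrightarrow> eval P \<rho> (IfE b e e') v (m + n + 1)"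
| eval_Bind: "eval P \<rho> e u m \<Longrightarrow> eval P (u # \<rho>) e' v n \<Longrightarrow> eval P \<rho> (Bind e e') v (m + n + 1)"
| eval_Call: "evals P \<rho> es us m \<Longrightarrow> f < length P \<Longrightarrow> eval P us (P ! f) v n \<Longrightarrow>
    eval P \<rho> (Call f es) v (m + n + 1)"
| evals_Nil: "evals P \<rho> [] [] 0"
| evals_Cons: "eval P \<rho> e v m \<Longrightarrow> evals P \<rho> es vs n \<Longrightarrow> evals P \<rho> (e # es) (v # vs) (m + n)"

inductive_cases eval_VarE: "eval P \<rho> (Var i) v n"
inductive_cases eval_NilE: "eval P \<rho> NilE v n"
inductive_cases eval_ConsE: "eval P \<rho> (ConsE e e') v n"
inductive_cases eval_HdE: "eval P \<rho> (HdE e) v n"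
inductive_cases eval_TlE: "eval P \<rho> (TlE e) v n"
inductive_cases eval_IfE: "eval P \<rho> (IfE b e e') v n"
inductive_cases eval_BindE: "eval P \<rho> (Bind e e') v n"
inductive_cases eval_CallE: "eval P \<rho> (Call f es) v n"
inductive_cases evals_NilE: "evals P \<rho> [] vs n"
inductive_cases evals_ConsE: "evals P \<rho> (e # es) vs n"

text \<open>Evaluation is deterministic, so result and cost are functions of program and input.\<close>

lemma eval_deterministic:
  shows "eval P \<rho> e v n \<Longrightarrow> eval P \<rho> e v' n' \<Longrightarrow> v = v' \<and> n = n'"
    and "evals P \<rho> es vs n \<Longrightarrow> evals P \<rho> es vs' n' \<Longrightarrow> vs = vs' \<and> n = n'"
proof (induction arbitrary: v' n' and vs' n' rule: eval_evals.inducts)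
  case eval_Var then show ?case by (auto elim: eval_VarE)
next
  case eval_Nil then show ?case by (auto elim: eval_NilE)
next
  case eval_Cons
  from eval_Cons.prems show ?case by (rule eval_ConsE) (use eval_Cons in \<open>metis Suc_eq_plus1\<close>)
next
  case eval_Hd
  from eval_Hd.prems show ?case by (rule eval_HdE) (use eval_Hd in \<open>metis Suc_eq_plus1\<close>)
next
  case eval_Tl
  from eval_Tl.prems show ?case by (rule eval_TlE) (use eval_Tl in \<open>metis Suc_eq_plus1\<close>)
next
  case eval_If_true
  from eval_If_true.prems show ?case by (rule eval_IfE) (use eval_If_true in \<open>metis Suc_eq_plus1\<close>)+
next
  case eval_If_false
  from eval_If_false.prems show ?case by (rule eval_IfE) (use eval_If_false in \<open>metis Suc_eq_plus1\<close>)+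
next
  case eval_Bind
  from eval_Bind.prems show ?case by (rule eval_BindE) (use eval_Bind in \<open>metis Suc_eq_plus1\<close>)
next
  case eval_Call
  from eval_Call.prems show ?case by (rule eval_CallE) (use eval_Call in \<open>metis Suc_eq_plus1\<close>)
next
  case evals_Nil then show ?case by (auto elim: evals_NilE)
next
  case evals_Cons
  from evals_Cons.prems show ?case by (rule evals_ConsE) (use evals_Cons in \<open>metis Suc_eq_plus1\<close>)
qed

text \<open>
  The program runs its function at position 0 on the input and answers yes by a value other
  than \<open>nil\<close>.
\<close>

definition runs :: "program \<Rightarrow> data \<Rightarrow> data \<Rightarrow> nat \<Rightarrow> bool" where
  "runs P inp out n \<longleftrightarrow> eval P [inp] (Call 0 [Var 0]) out n"

text \<open>
  Instances satisfying \<open>promise\<close> are to be decided; \<open>encodes i t\<close> says that \<open>t\<close> is an encoding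
  of the instance \<open>i\<close>, and \<open>yes i\<close> that \<open>i\<close> is a positive instance.  The size of a tree is
  the number of its \<open>cons\<close> nodes.
\<close>

definition poly_time_decidable ::
  "('i \<Rightarrow> bool) \<Rightarrow> ('i \<Rightarrow> data \<Rightarrow> bool) \<Rightarrow> ('i \<Rightarrow> bool) \<Rightarrow> bool" where
  "poly_time_decidable promise encodes yes \<longleftrightarrow>
     (\<exists>(P :: program) (q :: nat poly). \<forall>i t. promise i \<longrightarrow> encodes i t \<longrightarrow>
        (\<exists>out n. runs P t out n \<and> n \<le> poly q (size t) \<and> (out \<noteq> Dnil \<longleftrightarrow> yes i)))"


section \<open>Encoding of instances\<close>

text \<open>Binary notation, least significant digit first.\<close>

fun nat_code :: "nat \<Rightarrow> data" where
  "nat_code n =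
     (if n = 0 then Dnil
      else Dcons (if odd n then Dcons Dnil Dnil else Dnil) (nat_code (n div 2)))"

declare nat_code.simps [simp del]

definition list_code :: "('a \<Rightarrow> data) \<Rightarrow> 'a list \<Rightarrow> data" where
  "list_code c xs = foldr (\<lambda>x t. Dcons (c x) t) xs Dnil"

definition pair_code :: "('a \<Rightarrow> data) \<Rightarrow> ('b \<Rightarrow> data) \<Rightarrow> 'a \<times> 'b \<Rightarrow> data" where
  "pair_code c d p = Dcons (c (fst p)) (d (snd p))"

text \<open>A finite set is given by listing its elements without repetition in an arbitrary order.\<close>

definition set_encoding :: "('a \<Rightarrow> data) \<Rightarrow> 'a set \<Rightarrow> data \<Rightarrow> bool" where
  "set_encoding c S t \<longleftrightarrow> (\<exists>xs. distinct xs \<and> set xs = S \<and> t = list_code c xs)"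

text \<open>
  The input consists of the vertices of \<open>G\<close>, the arcs of \<open>G\<close>, the lists as the set of pairs
  \<open>(x, a)\<close> with \<open>a \<in> L x\<close>, and the value table of \<open>h\<close>.
\<close>

definition instance_encoding ::
  "nat \<Rightarrow> nat pair_pre_digraph \<times> (nat \<Rightarrow> nat set) \<times> (nat \<Rightarrow> nat list \<Rightarrow> nat) \<Rightarrow> data \<Rightarrow> bool" where
  "instance_encoding k = (\<lambda>(G, L, h) t. \<exists>tV tA tL th.
     t = Dcons tV (Dcons tA (Dcons tL th)) \<and>
     set_encoding nat_code (pverts G) tV \<and>
     set_encoding (pair_code nat_code nat_code) (parcs G) tA \<and>
     set_encoding (pair_code nat_code nat_code) (SIGMA x : pverts G. L x) tL \<and>
     set_encoding (pair_code nat_code (pair_code (list_code nat_code) nat_code))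
       {(x, as, h x as) | x as. x \<in> pverts G \<and> as \<in> tuples k (L x)} th)"

end

theory Submission
  imports Defs "HOL-Library.Sublist"
begin

text \<open>
  For each vertex \<open>x\<close>, the operation \<open>h(x; a, b, ..., b, c)\<close> is a Maltsev operation on \<open>L(x)\<close>, so the
  problem is a multi-sorted Maltsev constraint problem.  A relation \<open>R\<close> preserved by a Maltsev operation \<open>m\<close>
  has a compact representation with respect to an ordering of its coordinates: for each coordinate \<open>i\<close>
  and each pair of values at \<open>i\<close> taken by two members of \<open>R\<close> that agree on all earlier coordinates,
  store one such pair of members.  If \<open>(p, q)\<close> is stored for \<open>i\<close> and \<open>t \<in> R\<close> has the same value
  at \<open>i\<close> as \<open>p\<close>, then \<open>m(t, p, q)\<close> agrees with \<open>t\<close> on the earlier coordinates and has the value of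
  \<open>q\<close> at \<open>i\<close>.  With this exchange step two adjacent coordinates can be transposed, so every
  coordinate can be moved to the front, and a constraint on the first coordinate is imposed by
  filtering.  Taking the pairs of vertices of \<open>G\<close> as coordinates makes every arc a constraint on a single
  coordinate.  Starting from the product of the lists and imposing the arcs of \<open>G\<close> one by one,
  there is an \<open>L\<close>-homomorphism if and only if no stored list of pairs ends up empty.

  Polynomial time is established without writing down a program: the functions computable with
  polynomial cost and polynomial output size are closed under the list operations from which the
  algorithm is composed.
\<close>

section \<open>Compact representations of Maltsev relations\<close>

definition lookup :: "'b \<Rightarrow> ('a \<times> 'b) list \<Rightarrow> 'a \<Rightarrow> 'b" where
  "lookup d ps x = (case map_of ps x of None \<Rightarrow> d | Some y \<Rightarrow> y)"

lemma lookup_simps [simp]: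
  "lookup d [] x = d"
  "lookup d (p # ps) x = (if fst p = x then snd p else lookup d ps x)"
  by (simp_all add: lookup_def)

lemma lookup_absent: "x \<notin> fst ` set ps \<Longrightarrow> lookup d ps x = d"
  by (induction ps) auto

lemma lookup_mem: "x \<in> fst ` set ps \<Longrightarrow> (x, lookup d ps x) \<in> set ps"
  by (induction ps) auto

lemma lookup_unique:
  assumes "(x, a) \<in> set ps" "\<And>b. (x, b) \<in> set ps \<Longrightarrow> b = a"
  shows "lookup d ps x = a"
proof (rule assms(2))
  show "(x, lookup d ps x) \<in> set ps" by (rule lookup_mem) (use assms(1) in force)
qed

lemma lookup_map: "lookup d (map (\<lambda>x. (x, f x)) xs) x = (if x \<in> set xs then f x else d)"
  by (induction xs) auto

definition diagonal :: "'t list \<Rightarrow> ('t \<times> 't) list" where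
  "diagonal ts = map (\<lambda>t. (t, t)) ts"

lemma set_diagonal [simp]: "set (diagonal ts) = (\<lambda>t. (t, t)) ` set ts"
  by (simp add: diagonal_def)

type_synonym ('i, 't) entry = "'i \<times> ('t \<times> 't) list"

context
  fixes val :: "'t \<Rightarrow> 'i \<Rightarrow> 'v" and m :: "'t \<Rightarrow> 't \<Rightarrow> 't \<Rightarrow> 't" and Q A :: "'v list"
begin

definition agree_on :: "'i set \<Rightarrow> 't \<Rightarrow> 't \<Rightarrow> bool" where
  "agree_on S t u \<longleftrightarrow> (\<forall>i \<in> S. val t i = val u i)"

definition covers :: "'t set \<Rightarrow> 'i \<Rightarrow> 't list \<Rightarrow> bool" where
  "covers R i ts \<longleftrightarrow> set ts \<subseteq> R \<and> (\<forall>t \<in> R. \<exists>c \<in> set ts. val c i = val t i)"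

definition witnesses :: "'t set \<Rightarrow> 'i set \<Rightarrow> 'i \<Rightarrow> ('t \<times> 't) list \<Rightarrow> bool" where
  "witnesses R S i W \<longleftrightarrow>
     (\<forall>(p, q) \<in> set W. p \<in> R \<and> q \<in> R \<and> agree_on S p q) \<and>
     (\<forall>t \<in> R. \<forall>u \<in> R. agree_on S t u \<longrightarrow> (\<exists>(p, q) \<in> set W. val p i = val t i \<and> val q i = val u i))"

primrec represents :: "'t set \<Rightarrow> 'i set \<Rightarrow> ('i, 't) entry list \<Rightarrow> bool" where
  "represents R S [] \<longleftrightarrow> True"
| "represents R S (e # es) \<longleftrightarrow> witnesses R S (fst e) (snd e) \<and> represents R (insert (fst e) S) es"

text \<open>In a pair \<open>(t, s)\<close> of \<open>rs\<close>, \<open>t\<close> is the start and \<open>s\<close> the current end of a chain of exchange steps.\<close>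

definition exchange :: "('i, 't) entry \<Rightarrow> ('t \<times> 't) list \<Rightarrow> ('t \<times> 't) list" where
  "exchange e rs = concat (map (\<lambda>(t, s).
     map (\<lambda>(p, q). (t, m s p q)) (filter (\<lambda>(p, q). val p (fst e) = val s (fst e)) (snd e))) rs)"

text \<open>Pruning keeps an entry at most as long as the square of the number of values.\<close>

definition prune :: "('i, 't) entry \<Rightarrow> ('i, 't) entry" where
  "prune e = (fst e, concat (map (\<lambda>c.
     take 1 (filter (\<lambda>(p, q). (val p (fst e), val q (fst e)) = c) (snd e))) (List.product Q Q)))"

definition exchange_both :: "('i, 't) entry \<Rightarrow> ('i, 't) entry \<Rightarrow> 't list \<Rightarrow> ('t \<times> 't) list" where
  "exchange_both e f ts = exchange f (exchange e (diagonal ts))"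

definition transpose_entries :: "('i, 't) entry \<Rightarrow> ('i, 't) entry \<Rightarrow> ('i, 't) entry list" where
  "transpose_entries e f =
     [prune (fst f, exchange_both e f (map fst (snd f))),
      prune (fst e, filter (\<lambda>(p, q). val p (fst f) = val q (fst f))
        (exchange_both e f (map fst (snd e))))]"

definition entry_at :: "('i, 't) entry list \<Rightarrow> 'i \<Rightarrow> ('i, 't) entry" where
  "entry_at es i = (i, lookup [] es i)"

text \<open>If \<open>i\<close> occurs in \<open>es\<close>, it has already been moved to the front of \<open>es\<close>, hence \<open>tl es\<close>.\<close>

definition swap_step :: "'i \<Rightarrow> ('i, 't) entry \<Rightarrow> ('i, 't) entry list \<Rightarrow> ('i, 't) entry list" where
  "swap_step i e es =
     (if i \<in> set (map fst es) then transpose_entries e (entry_at es i) @ tl es else e # es)"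

definition move_to_front :: "'i \<Rightarrow> ('i, 't) entry list \<Rightarrow> ('i, 't) entry list" where
  "move_to_front i es = foldr (swap_step i) es []"

definition candidates :: "'i \<Rightarrow> 'i \<Rightarrow> ('i, 't) entry list \<Rightarrow> 't list" where
  "candidates j i es = map snd (filter (\<lambda>(t, s). val s j \<in> set A)
     (exchange (entry_at es j) (diagonal (map fst (snd (entry_at es i))))))"

text \<open>
  The filter takes effect only in the entry of \<open>j\<close> itself: \<open>j\<close> is the first coordinate, so exchange steps
  at the other coordinates preserve the value at \<open>j\<close>.
\<close>

definition constrain_entry :: "'i \<Rightarrow> ('i, 't) entry list \<Rightarrow> ('i, 't) entry \<Rightarrow> ('i, 't) entry" where
  "constrain_entry j es e = prune (fst e, filter (\<lambda>(t, s). val s j \<in> set A)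
     (exchange e (diagonal (candidates j (fst e) (move_to_front (fst e) es)))))"

definition constrain :: "'i \<Rightarrow> ('i, 't) entry list \<Rightarrow> ('i, 't) entry list" where
  "constrain j es = map (constrain_entry j (move_to_front j es)) (move_to_front j es)"

end

lemma mem_exchange:
  "(t, s') \<in> set (exchange val m e rs) \<longleftrightarrow>
     (\<exists>s p q. (t, s) \<in> set rs \<and> (p, q) \<in> set (snd e) \<and> val p (fst e) = val s (fst e) \<and> s' = m s p q)"
  unfolding exchange_def by fastforce

lemma fst_prune [simp]: "fst (prune val Q e) = fst e"
  by (simp add: prune_def)

lemma set_prune_subset: "set (snd (prune val Q e)) \<subseteq> set (snd e)"
  unfolding prune_def by (auto dest: in_set_takeD)

lemma prune_complete:
  assumes "(p, q) \<in> set (snd e)" "val p (fst e) \<in> set Q" "val q (fst e) \<in> set Q"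
  obtains p' q' where "(p', q') \<in> set (snd (prune val Q e))"
    "val p' (fst e) = val p (fst e)" "val q' (fst e) = val q (fst e)"
proof -
  let ?W = "filter (\<lambda>(p', q'). (val p' (fst e), val q' (fst e)) = (val p (fst e), val q (fst e))) (snd e)"
  obtain r W where "?W = r # W"
    using assms(1) by (cases ?W) (auto simp: filter_empty_conv)
  then have "r \<in> set (take 1 ?W)" "r \<in> set ?W" by simp_all
  moreover from this assms(2,3) have "r \<in> set (snd (prune val Q e))"
    unfolding prune_def by force
  ultimately show thesis using that by (cases r) auto
qed

lemma fst_transpose_entries [simp]: "map fst (transpose_entries val m Q e f) = [fst f, fst e]"
  by (simp add: transpose_entries_def)

lemma fst_entry_at [simp]: "fst (entry_at es i) = i"
  by (simp add: entry_at_def)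

lemma move_to_front_Nil: "move_to_front val m Q i [] = []"
  by (simp add: move_to_front_def)

lemma move_to_front_Cons:
  "move_to_front val m Q i (e # es) = swap_step val m Q i e (move_to_front val m Q i es)"
  by (simp add: move_to_front_def)

lemma move_to_front_absent: "i \<notin> set (map fst es) \<Longrightarrow> move_to_front val m Q i es = es"
  by (induction es) (simp_all add: move_to_front_Nil move_to_front_Cons swap_step_def)

lemma map_fst_move_to_front:
  assumes "distinct (map fst es)" "i \<in> set (map fst es)"
  shows "map fst (move_to_front val m Q i es) = i # remove1 i (map fst es)"
  using assms
proof (induction es)
  case (Cons e es)
  show ?case
  proof (cases "fst e = i")
    case True
    with Cons.prems have "i \<notin> set (map fst es)" by auto
    with True show ?thesis by (simp add: move_to_front_Cons move_to_front_absent swap_step_def)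
  next
    case False
    with Cons have "map fst (move_to_front val m Q i es) = i # remove1 i (map fst es)" by simp
    with False show ?thesis
      by (simp add: move_to_front_Cons swap_step_def map_tl)
  qed
qed simp

lemma fst_constrain_entry [simp]: "fst (constrain_entry val m Q A j es e) = fst e"
  by (simp add: constrain_entry_def)

lemma map_fst_constrain: "map fst (constrain val m Q A j es) = map fst (move_to_front val m Q j es)"
  by (simp add: constrain_def o_def)

lemma witnessesI:
  assumes "\<And>p q. (p, q) \<in> set W \<Longrightarrow> p \<in> R \<and> q \<in> R \<and> agree_on val S p q"
    and "\<And>t u. t \<in> R \<Longrightarrow> u \<in> R \<Longrightarrow> agree_on val S t u \<Longrightarrow>
      \<exists>(p, q) \<in> set W. val p i = val t i \<and> val q i = val u i"
  shows "witnesses val R S i W"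
  using assms unfolding witnesses_def by blast

lemma witnesses_sound:
  assumes "witnesses val R S i W" "(p, q) \<in> set W"
  shows "p \<in> R" "q \<in> R" "agree_on val S p q"
  using assms unfolding witnesses_def by blast+

lemma witnesses_complete:
  assumes "witnesses val R S i W" "t \<in> R" "u \<in> R" "agree_on val S t u"
  obtains p q where "(p, q) \<in> set W" "val p i = val t i" "val q i = val u i"
  using assms unfolding witnesses_def by blast

lemma covers_if_witnesses:
  assumes "witnesses val R S i W"
  shows "covers val R i (map fst W)"
  unfolding covers_def
proof (intro conjI ballI)
  show "set (map fst W) \<subseteq> R" using witnesses_sound(1)[OF assms] by auto
  fix t assume "t \<in> R"
  moreover have "agree_on val S t t" by (simp add: agree_on_def)
  ultimately obtain p q where "(p, q) \<in> set W" "val p i = val t i"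
    using witnesses_complete[OF assms] by metis
  then show "\<exists>c \<in> set (map fst W). val c i = val t i" by force
qed

lemma represents_append:
  "represents val R S (es @ fs) \<longleftrightarrow>
     represents val R S es \<and> represents val R (S \<union> fst ` set es) fs"
  by (induction es arbitrary: S) simp_all

lemma represents_mapI:
  assumes "\<And>us x vs. xs = us @ x # vs \<Longrightarrow> witnesses val R (S \<union> f ` set us) (f x) (g x)"
  shows "represents val R S (map (\<lambda>x. (f x, g x)) xs)"
  using assms
proof (induction xs arbitrary: S)
  case (Cons x xs)
  have "witnesses val R S (f x) (g x)" using Cons.prems[of "[]"] by simp
  moreover have "represents val R (insert (f x) S) (map (\<lambda>x. (f x, g x)) xs)"
  proof (rule Cons.IH)
    fix us y vs assume "xs = us @ y # vs"
    then show "witnesses val R (insert (f x) S \<union> f ` set us) (f y) (g y)"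
      using Cons.prems[of "x # us"] by simp
  qed
  ultimately show ?case by simp
qed simp

lemma witnesses_entry_at:
  assumes "represents val R S es" "map fst es = ks @ i # js" "i \<notin> set ks"
  shows "witnesses val R (S \<union> set ks) i (snd (entry_at es i))"
  using assms
proof (induction ks arbitrary: S es)
  case Nil
  then show ?case by (cases es) (auto simp: entry_at_def)
next
  case (Cons j ks)
  then obtain e es' where "es = e # es'" "fst e = j" "map fst es' = ks @ i # js"
    by (cases es) auto
  moreover from this Cons.prems have "witnesses val R (insert j S \<union> set ks) i (snd (entry_at es' i))"
    by (intro Cons.IH) simp_all
  ultimately show ?case using Cons.prems(3) by (auto simp: entry_at_def)
qed

lemma witnesses_entry_at_front:
  assumes "represents val R {} es" "map fst es = i # ks" "j \<noteq> i \<Longrightarrow> \<exists>js. ks = j # js"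
  shows "witnesses val R {} i (snd (entry_at es i))"
    and "witnesses val R ({i} - {j}) j (snd (entry_at es j))"
proof -
  show front: "witnesses val R {} i (snd (entry_at es i))"
    using witnesses_entry_at[OF assms(1), of "[]"] assms(2) by simp
  show "witnesses val R ({i} - {j}) j (snd (entry_at es j))"
  proof (cases "j = i")
    case True
    with front show ?thesis by simp
  next
    case False
    with assms(2,3) obtain js where "map fst es = [i] @ j # js" by auto
    from witnesses_entry_at[OF assms(1) this] False show ?thesis by simp
  qed
qed

locale maltsev_relation =
  fixes val :: "'t \<Rightarrow> 'i \<Rightarrow> 'v" and m :: "'t \<Rightarrow> 't \<Rightarrow> 't \<Rightarrow> 't" and Q :: "'v list" and R :: "'t set"
  assumes closed: "t \<in> R \<Longrightarrow> u \<in> R \<Longrightarrow> v \<in> R \<Longrightarrow> m t u v \<in> R"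
    and cancel_right: "t \<in> R \<Longrightarrow> u \<in> R \<Longrightarrow> v \<in> R \<Longrightarrow> val u i = val v i \<Longrightarrow> val (m t u v) i = val t i"
    and cancel_left: "t \<in> R \<Longrightarrow> u \<in> R \<Longrightarrow> v \<in> R \<Longrightarrow> val t i = val u i \<Longrightarrow> val (m t u v) i = val v i"
    and val_mem: "t \<in> R \<Longrightarrow> val t i \<in> set Q"
begin

lemma agree_on_transfer:
  assumes "t \<in> R" "u \<in> R" "v \<in> R" "agree_on val S u v"
  shows "agree_on val S t (m t u v)"
  using assms cancel_right unfolding agree_on_def by simp

lemma witnesses_prune:
  assumes "witnesses val R S (fst e) (snd e)"
  shows "witnesses val R S (fst e) (snd (prune val Q e))"
proof (rule witnessesI)
  show "p \<in> R \<and> q \<in> R \<and> agree_on val S p q" if "(p, q) \<in> set (snd (prune val Q e))" for p q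
    using that set_prune_subset witnesses_sound[OF assms] by blast
  fix t u assume "t \<in> R" "u \<in> R" "agree_on val S t u"
  with assms obtain p q where pair: "(p, q) \<in> set (snd e)"
    "val p (fst e) = val t (fst e)" "val q (fst e) = val u (fst e)"
    by (rule witnesses_complete)
  moreover from this have "val p (fst e) \<in> set Q" "val q (fst e) \<in> set Q"
    using val_mem \<open>t \<in> R\<close> \<open>u \<in> R\<close> by simp_all
  ultimately obtain p' q' where "(p', q') \<in> set (snd (prune val Q e))"
    "val p' (fst e) = val p (fst e)" "val q' (fst e) = val q (fst e)"
    using prune_complete by metis
  with pair(2,3) show "\<exists>(p, q) \<in> set (snd (prune val Q e)).
      val p (fst e) = val t (fst e) \<and> val q (fst e) = val u (fst e)"
    by force
qed

lemma exchange_sound: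
  assumes "witnesses val R S (fst e) (snd e)" "snd ` set rs \<subseteq> R"
    "(t, s') \<in> set (exchange val m e rs)"
  obtains s where "(t, s) \<in> set rs" "s' \<in> R" "agree_on val S s s'"
proof -
  from assms(3) obtain s p q where "(t, s) \<in> set rs" and pair: "(p, q) \<in> set (snd e)"
    and "s' = m s p q"
    unfolding mem_exchange by blast
  moreover from this assms(2) have "s \<in> R" by force
  ultimately show thesis
    using that closed agree_on_transfer witnesses_sound[OF assms(1) pair] by blast
qed

lemma exchange_complete:
  assumes "witnesses val R S (fst e) (snd e)" "(t, s) \<in> set rs" "s \<in> R" "u \<in> R" "agree_on val S s u"
  obtains s' where "(t, s') \<in> set (exchange val m e rs)" "s' \<in> R"
    "agree_on val (insert (fst e) S) s' u"
proof -
  obtain p q where pair: "(p, q) \<in> set (snd e)" "val p (fst e) = val s (fst e)"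
    "val q (fst e) = val u (fst e)"
    using witnesses_complete[OF assms(1,3-5)] by blast
  note in_R = \<open>s \<in> R\<close> witnesses_sound(1,2)[OF assms(1) pair(1)]
  have "agree_on val S s (m s p q)"
    by (intro agree_on_transfer in_R witnesses_sound(3)[OF assms(1) pair(1)])
  moreover have "val (m s p q) (fst e) = val u (fst e)"
    using cancel_left[OF in_R] pair by simp
  ultimately have "agree_on val (insert (fst e) S) (m s p q) u"
    using assms(5) by (simp add: agree_on_def)
  moreover have "(t, m s p q) \<in> set (exchange val m e rs)"
    unfolding mem_exchange using assms(2) pair by blast
  ultimately show thesis using that closed[OF in_R] by blast
qed

text \<open>
  A pair \<open>(t, u)\<close> is traded for a pair that starts at a member \<open>c\<close> of the cover with the value of \<open>t\<close>
  at \<open>i\<close>: the tuple \<open>m c t u\<close> agrees with \<open>c\<close> on \<open>S\<close> and with \<open>u\<close> at \<open>i\<close>.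
\<close>

lemma witnesses_if_covers:
  assumes cover: "covers val R i ts"
    and sound: "\<And>c s. (c, s) \<in> set W \<Longrightarrow> c \<in> R \<and> s \<in> R \<and> agree_on val S c s"
    and complete: "\<And>c u. c \<in> set ts \<Longrightarrow> c \<in> R \<Longrightarrow> u \<in> R \<Longrightarrow> agree_on val S c u \<Longrightarrow>
      \<exists>s. (c, s) \<in> set W \<and> val s i = val u i"
  shows "witnesses val R S i W"
proof (rule witnessesI)
  fix t u assume agreeing: "t \<in> R" "u \<in> R" "agree_on val S t u"
  with cover obtain c where covering: "c \<in> set ts" "c \<in> R" "val c i = val t i"
    unfolding covers_def by blast
  have "m c t u \<in> R" "agree_on val S c (m c t u)" "val (m c t u) i = val u i"
    using covering agreeing by (simp_all add: closed agree_on_transfer cancel_left)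
  with complete[OF covering(1,2)] obtain s where "(c, s) \<in> set W" "val s i = val u i" by metis
  with covering(3) show "\<exists>(p, q) \<in> set W. val p i = val t i \<and> val q i = val u i" by blast
qed (rule sound)

lemma exchange_both_sound:
  assumes witnesses_e: "witnesses val R S (fst e) (snd e)"
    and witnesses_f: "witnesses val R (insert (fst e) S) (fst f) (snd f)"
    and start: "set ts \<subseteq> R" "(t, s) \<in> set (exchange_both val m e f ts)"
  shows "t \<in> R" "s \<in> R" "agree_on val S t s"
proof -
  let ?rs = "exchange val m e (diagonal ts)"
  have diagonal_in_R: "snd ` set (diagonal ts) \<subseteq> R" using start(1) by auto
  have first_exchange: "t' \<in> R \<and> s' \<in> R \<and> agree_on val S t' s'" if "(t', s') \<in> set ?rs" for t' s'
    using exchange_sound[OF witnesses_e diagonal_in_R that] start(1) by auto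
  then have "snd ` set ?rs \<subseteq> R" by auto
  with witnesses_f obtain s' where "(t, s') \<in> set ?rs" "s \<in> R"
    "agree_on val (insert (fst e) S) s' s"
    using start(2) unfolding exchange_both_def by (rule exchange_sound)
  with first_exchange[of t s'] show "t \<in> R" "s \<in> R" "agree_on val S t s"
    by (auto simp: agree_on_def)
qed

lemma exchange_both_complete:
  assumes witnesses_e: "witnesses val R S (fst e) (snd e)"
    and witnesses_f: "witnesses val R (insert (fst e) S) (fst f) (snd f)"
    and start: "t \<in> set ts" "t \<in> R" and target: "u \<in> R" "agree_on val S t u"
  obtains s where "(t, s) \<in> set (exchange_both val m e f ts)" "val s (fst e) = val u (fst e)"
    "val s (fst f) = val u (fst f)"
proof -
  have "(t, t) \<in> set (diagonal ts)" using start(1) by simp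
  with witnesses_e start(2) target obtain s where
    "(t, s) \<in> set (exchange val m e (diagonal ts))" "s \<in> R"
    "agree_on val (insert (fst e) S) s u"
    by (metis exchange_complete)
  with witnesses_f target(1) obtain s' where "(t, s') \<in> set (exchange_both val m e f ts)"
    "agree_on val (insert (fst f) (insert (fst e) S)) s' u"
    unfolding exchange_both_def by (metis exchange_complete)
  then show thesis using that by (simp add: agree_on_def)
qed

lemma represents_transpose_entries:
  assumes witnesses_e: "witnesses val R S (fst e) (snd e)"
    and witnesses_f: "witnesses val R (insert (fst e) S) (fst f) (snd f)"
  shows "represents val R S (transpose_entries val m Q e f)"
proof -
  let ?F = "exchange_both val m e f (map fst (snd f))"
  let ?E = "filter (\<lambda>(p, q). val p (fst f) = val q (fst f)) (exchange_both val m e f (map fst (snd e)))"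
  have covers: "covers val R (fst e) (map fst (snd e))" "covers val R (fst f) (map fst (snd f))"
    using witnesses_e witnesses_f by (auto intro: covers_if_witnesses)
  then have subset: "set (map fst (snd e)) \<subseteq> R" "set (map fst (snd f)) \<subseteq> R"
    unfolding covers_def by simp_all
  have "witnesses val R S (fst f) ?F"
  proof (rule witnesses_if_covers[OF covers(2)])
    show "c \<in> R \<and> s \<in> R \<and> agree_on val S c s" if "(c, s) \<in> set ?F" for c s
      using exchange_both_sound[OF witnesses_e witnesses_f subset(2) that] by simp
    show "\<exists>s. (c, s) \<in> set ?F \<and> val s (fst f) = val u (fst f)"
      if "c \<in> set (map fst (snd f))" "c \<in> R" "u \<in> R" "agree_on val S c u" for c u
      using exchange_both_complete[OF witnesses_e witnesses_f that] by metis
  qed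
  moreover have "witnesses val R (insert (fst f) S) (fst e) ?E"
  proof (rule witnesses_if_covers[OF covers(1)])
    show "c \<in> R \<and> s \<in> R \<and> agree_on val (insert (fst f) S) c s" if "(c, s) \<in> set ?E" for c s
      using exchange_both_sound[OF witnesses_e witnesses_f subset(1), of c s] that
      by (simp add: agree_on_def)
    fix c u assume "c \<in> set (map fst (snd e))" "c \<in> R" "u \<in> R" "agree_on val (insert (fst f) S) c u"
    moreover from this obtain s where "(c, s) \<in> set (exchange_both val m e f (map fst (snd e)))"
      "val s (fst e) = val u (fst e)" "val s (fst f) = val u (fst f)"
      using exchange_both_complete[OF witnesses_e witnesses_f, of c "map fst (snd e)" u]
      unfolding agree_on_def by blast
    ultimately show "\<exists>s. (c, s) \<in> set ?E \<and> val s (fst e) = val u (fst e)"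
      by (auto simp: agree_on_def)
  qed
  ultimately show ?thesis
    using witnesses_prune[of S "(fst f, ?F)"] witnesses_prune[of "insert (fst f) S" "(fst e, ?E)"]
    by (simp add: transpose_entries_def)
qed

lemma represents_move_to_front:
  assumes "represents val R S es" "distinct (map fst es)" "i \<in> set (map fst es)"
  shows "represents val R S (move_to_front val m Q i es)"
  using assms
proof (induction es arbitrary: S)
  case (Cons e es)
  show ?case
  proof (cases "fst e = i")
    case True
    with Cons.prems have "i \<notin> set (map fst es)" by auto
    with True Cons.prems(1) show ?thesis
      by (simp add: move_to_front_Cons move_to_front_absent swap_step_def)
  next
    case False
    let ?S = "insert (fst e) S" and ?M = "move_to_front val m Q i es"
    from False Cons have represented: "represents val R ?S ?M" by simp
    from False Cons.prems have "map fst ?M = i # remove1 i (map fst es)"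
      by (intro map_fst_move_to_front) auto
    then obtain f fs where front: "?M = f # fs" "fst f = i" by (cases ?M) auto
    then have "entry_at ?M i = f" by (simp add: entry_at_def prod_eq_iff)
    moreover have "represents val R S (transpose_entries val m Q e f)"
      using Cons.prems(1) represented front by (intro represents_transpose_entries) simp_all
    moreover have "fst ` set (transpose_entries val m Q e f) = {fst e, fst f}"
      by (auto simp: transpose_entries_def)
    ultimately show ?thesis
      using represented front
      by (simp add: move_to_front_Cons swap_step_def represents_append insert_commute)
  qed
qed simp

lemma covers_candidates:
  assumes first: "witnesses val R {} i (snd (entry_at es i))"
    and second: "witnesses val R ({i} - {j}) j (snd (entry_at es j))"
  shows "covers val {t \<in> R. val t j \<in> set A} i (candidates val m A j i es)"
proof -
  let ?ts = "map fst (snd (entry_at es i))"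
  let ?rs = "exchange val m (entry_at es j) (diagonal ?ts)"
  have entry: "witnesses val R ({i} - {j}) (fst (entry_at es j)) (snd (entry_at es j))"
    using second by simp
  have covers_ts: "covers val R i ?ts" using first by (rule covers_if_witnesses)
  then have "snd ` set (diagonal ?ts) \<subseteq> R" by (auto simp: covers_def)
  with entry have exchange_mem: "s \<in> R" if "(t, s) \<in> set ?rs" for t s
    using that by (rule exchange_sound)
  show ?thesis
    unfolding covers_def
  proof (intro conjI ballI)
    show "set (candidates val m A j i es) \<subseteq> {t \<in> R. val t j \<in> set A}"
      using exchange_mem by (auto simp: candidates_def)
    fix t assume t_mem: "t \<in> {t \<in> R. val t j \<in> set A}"
    with covers_ts obtain c where "c \<in> set ?ts" "c \<in> R" "val c i = val t i"
      unfolding covers_def by blast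
    then have "(c, c) \<in> set (diagonal ?ts)" "c \<in> R" "agree_on val ({i} - {j}) c t"
      by (simp_all add: agree_on_def)
    with entry t_mem obtain s where "(c, s) \<in> set ?rs" "agree_on val (insert j ({i} - {j})) s t"
      using exchange_complete[of "{i} - {j}" "entry_at es j" c c "diagonal ?ts" t] by auto
    moreover from this(2) have "val s j = val t j" "val s i = val t i" by (auto simp: agree_on_def)
    ultimately show "\<exists>c \<in> set (candidates val m A j i es). val c i = val t i"
      using t_mem by (force simp: candidates_def)
  qed
qed

lemma witnesses_constrain_entry:
  fixes A j defines "R' \<equiv> {t \<in> R. val t j \<in> set A}"
  assumes maltsev_R': "maltsev_relation val m Q R'"
    and represented: "represents val R {} es" "distinct (map fst es)" "map fst es = j # ks"
    and entry: "witnesses val R S (fst e) (snd e)" "fst e \<in> set (map fst es)" "j \<in> insert (fst e) S"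
  shows "witnesses val R' S (fst e) (snd (constrain_entry val m Q A j es e))"
proof -
  interpret R': maltsev_relation val m Q R' by (rule maltsev_R')
  let ?M = "move_to_front val m Q (fst e) es"
  let ?C = "candidates val m A j (fst e) ?M"
  let ?W = "filter (\<lambda>(t, s). val s j \<in> set A) (exchange val m e (diagonal ?C))"
  have "map fst ?M = fst e # remove1 (fst e) (map fst es)" "represents val R {} ?M"
    using represented entry(2) by (simp_all add: map_fst_move_to_front represents_move_to_front)
  then have cover: "covers val R' (fst e) ?C"
    unfolding R'_def
    by (intro covers_candidates witnesses_entry_at_front) (use represented(3) in auto)
  then have candidates_in: "set ?C \<subseteq> R'" and diagonal_in_R: "snd ` set (diagonal ?C) \<subseteq> R"
    unfolding covers_def R'_def by auto
  have "witnesses val R' S (fst e) ?W"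
  proof (rule R'.witnesses_if_covers[OF cover])
    fix c s assume exchanged: "(c, s) \<in> set ?W"
    then have "(c, s) \<in> set (exchange val m e (diagonal ?C))" by simp
    with entry(1) diagonal_in_R obtain c' where
      "(c, c') \<in> set (diagonal ?C)" "s \<in> R" "agree_on val S c' s"
      by (rule exchange_sound)
    with exchanged candidates_in show "c \<in> R' \<and> s \<in> R' \<and> agree_on val S c s" by (auto simp: R'_def)
  next
    fix c u assume "c \<in> set ?C" and "c \<in> R'" and u_mem: "u \<in> R'" and "agree_on val S c u"
    then have "(c, c) \<in> set (diagonal ?C)" "c \<in> R" "u \<in> R" "agree_on val S c u"
      by (simp_all add: R'_def)
    with entry(1) obtain s where "(c, s) \<in> set (exchange val m e (diagonal ?C))"
      "agree_on val (insert (fst e) S) s u"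
      by (metis exchange_complete)
    moreover from this have "val s j = val u j" "val s (fst e) = val u (fst e)"
      using entry(3) by (auto simp: agree_on_def)
    ultimately show "\<exists>s. (c, s) \<in> set ?W \<and> val s (fst e) = val u (fst e)"
      using u_mem by (auto simp: R'_def)
  qed
  from R'.witnesses_prune[of S "(fst e, ?W)"] this show ?thesis
    by (simp add: constrain_entry_def)
qed

lemma represents_constrain:
  assumes maltsev: "maltsev_relation val m Q {t \<in> R. val t j \<in> set A}"
    and represented: "represents val R {} es" "distinct (map fst es)" "j \<in> set (map fst es)"
  shows "represents val {t \<in> R. val t j \<in> set A} {} (constrain val m Q A j es)"
proof -
  let ?M = "move_to_front val m Q j es"
  have front: "represents val R {} ?M" "distinct (map fst ?M)"
    "map fst ?M = j # remove1 j (map fst es)"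
    using represented by (simp_all add: represents_move_to_front map_fst_move_to_front distinct_remove1)
  have rest: "represents val {t \<in> R. val t j \<in> set A} S (map (constrain_entry val m Q A j ?M) fs)"
    if "represents val R S fs" "set fs \<subseteq> set ?M" "j \<in> S \<or> fs = ?M" for S fs
    using that
  proof (induction fs arbitrary: S)
    case (Cons e fs)
    have "j \<in> insert (fst e) S" using Cons.prems(3) front(3)
      by (metis insert_iff list.inject list.simps(9))
    moreover from this Cons have "represents val {t \<in> R. val t j \<in> set A} (insert (fst e) S)
        (map (constrain_entry val m Q A j ?M) fs)" by simp
    ultimately show ?case
      using Cons.prems witnesses_constrain_entry[OF maltsev front] by simp
  qed simp
  show ?thesis unfolding constrain_def using front(1) by (intro rest) simp_all
qed

end

lemma distinct_set_map_fst_constrain: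
  assumes "distinct (map fst es)" "j \<in> set (map fst es)"
  shows "distinct (map fst (constrain val m Q A j es))"
    and "set (map fst (constrain val m Q A j es)) = set (map fst es)"
  using assms unfolding map_fst_constrain map_fst_move_to_front[OF assms] by auto

lemma represents_foldr_constrain:
  assumes "\<And>C. C \<subseteq> set js \<Longrightarrow> maltsev_relation val m Q {t \<in> R. \<forall>j \<in> C. val t j \<in> set A}"
    and "represents val R {} es" "distinct (map fst es)" "set js \<subseteq> set (map fst es)"
  shows "represents val {t \<in> R. \<forall>j \<in> set js. val t j \<in> set A} {} (foldr (constrain val m Q A) js es) \<and>
    distinct (map fst (foldr (constrain val m Q A) js es)) \<and>
    set (map fst (foldr (constrain val m Q A) js es)) = set (map fst es)"
  using assms
proof (induction js)
  case Nil
  from Nil.prems(2,3) show ?case by simp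
next
  case (Cons j js)
  let ?fs = "foldr (constrain val m Q A) js es" and ?R = "{t \<in> R. \<forall>j \<in> set js. val t j \<in> set A}"
  have IH: "represents val ?R {} ?fs" "distinct (map fst ?fs)"
    "set (map fst ?fs) = set (map fst es)"
    using Cons.IH Cons.prems by (auto simp del: set_map)
  have coordinate: "j \<in> set (map fst ?fs)" using IH(3) Cons.prems(4) by simp
  have filter_eq: "{t \<in> ?R. val t j \<in> set A} = {t \<in> R. \<forall>i \<in> set (j # js). val t i \<in> set A}" by auto
  interpret maltsev_relation val m Q ?R by (rule Cons.prems(1)) auto
  have "represents val {t \<in> ?R. val t j \<in> set A} {} (constrain val m Q A j ?fs)"
    using Cons.prems(1)[of "set (j # js)"] IH(1,2) coordinate unfolding filter_eq[symmetric]
    by (intro represents_constrain) simp_all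
  with distinct_set_map_fst_constrain[OF IH(2) coordinate, of val m Q A] IH(3) show ?case
    unfolding filter_eq by (simp del: set_map)
qed

lemma represents_empty_iff:
  assumes "represents val R S es" "e \<in> set es"
  shows "snd e = [] \<longleftrightarrow> R = {}"
  using assms
proof (induction es arbitrary: S)
  case (Cons f es)
  then have "covers val R (fst f) (map fst (snd f))"
    by (intro covers_if_witnesses[of val R S]) simp
  then have "snd f = [] \<longleftrightarrow> R = {}"
    unfolding covers_def by (cases "snd f") auto
  with Cons show ?case by auto
qed simp

section \<open>Functions computable in polynomial time\<close>

class encodable =
  fixes encode :: "'a \<Rightarrow> data"
  assumes encode_inject [simp]: "encode x = encode y \<longleftrightarrow> x = y"

instantiation bool :: encodable
begin
definition "encode b = (if b then Dcons Dnil Dnil else Dnil)"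
instance by standard (simp add: encode_bool_def)
end

lemma nat_code_inject: "nat_code m = nat_code n \<longleftrightarrow> m = n"
proof (induction m arbitrary: n rule: less_induct)
  case (less m)
  show ?case
  proof (cases "m = 0 \<or> n = 0")
    case True
    then show ?thesis by (auto simp: nat_code.simps[of m] nat_code.simps[of n])
  next
    case False
    then have "nat_code m = nat_code n \<longleftrightarrow> (odd m \<longleftrightarrow> odd n) \<and> m div 2 = n div 2"
      using less.IH[of "m div 2" "n div 2"] by (simp add: nat_code.simps[of m] nat_code.simps[of n])
    also have "\<dots> \<longleftrightarrow> m = n"
      by (metis bit_eq_rec)
    finally show ?thesis .
  qed
qed

instantiation nat :: encodable
begin
definition "encode (n :: nat) = nat_code n"
instance by standard (simp add: encode_nat_def nat_code_inject)
end

instantiation prod :: (encodable, encodable) encodable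
begin
definition "encode p = pair_code encode encode p"
instance by standard (auto simp: encode_prod_def pair_code_def prod_eq_iff)
end

instantiation list :: (encodable) encodable
begin
definition "encode xs = list_code encode xs"
instance
proof
  fix xs ys :: "'a list"
  show "encode xs = encode ys \<longleftrightarrow> xs = ys"
    unfolding encode_list_def list_code_def
  proof (induction xs arbitrary: ys)
    case Nil
    then show ?case by (cases ys) simp_all
  next
    case (Cons x xs)
    then show ?case by (cases ys) simp_all
  qed
qed
end

lemma encode_simps [simp]:
  "encode [] = Dnil" "encode (x # xs) = Dcons (encode x) (encode xs)"
  "encode (a, b) = Dcons (encode a) (encode b)"
  "encode True = Dcons Dnil Dnil" "encode False = Dnil" "encode (0 :: nat) = Dnil"
  by (simp_all add: encode_list_def list_code_def encode_prod_def pair_code_def encode_bool_def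
      encode_nat_def nat_code.simps[of 0])

lemma encode_fst: "encode (fst p) = dhd (encode p)"
  by (cases p) simp

lemma encode_snd: "encode (snd p) = dtl (encode p)"
  by (cases p) simp

lemma encode_tl: "encode (tl xs) = dtl (encode xs)"
  by (cases xs) simp_all

lemma size_dhd_le: "size (dhd v) \<le> size v"
  by (cases v) simp_all

lemma size_dtl_le: "size (dtl v) \<le> size v"
  by (cases v) simp_all

lemma size_encode_bool: "size (encode (b :: bool)) \<le> 1"
  by (cases b) simp_all

lemma size_encode_append [simp]: "size (encode (xs @ ys)) = size (encode xs) + size (encode ys)"
  by (induction xs) simp_all

lemma size_encode_member: "x \<in> set xs \<Longrightarrow> size (encode x) < size (encode xs)"
  by (induction xs) auto

lemma length_le_size_encode: "length xs \<le> size (encode xs)"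
  by (induction xs) simp_all

lemma size_encode_list_le:
  "(\<And>x. x \<in> set xs \<Longrightarrow> size (encode x) \<le> b) \<Longrightarrow> size (encode xs) \<le> length xs * (b + 1)"
proof (induction xs)
  case (Cons x xs)
  from Cons.prems[of x] Cons.IH[OF Cons.prems] show ?case by simp
qed simp

subsection \<open>Polynomial bounds\<close>

definition env_size :: "('s \<Rightarrow> data) list \<Rightarrow> 's \<Rightarrow> nat" where
  "env_size E s = 2 + (\<Sum>f\<leftarrow>E. size (f s))"

definition poly_bounded :: "('s \<Rightarrow> data) list \<Rightarrow> ('s \<Rightarrow> nat) \<Rightarrow> bool" where
  "poly_bounded E c \<longleftrightarrow> (\<exists>d. \<forall>s. c s \<le> env_size E s ^ d)"

named_theorems poly_bounded_intros

lemma poly_boundedE: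
  assumes "poly_bounded E c"
  obtains d where "\<And>s. c s \<le> env_size E s ^ d"
  using assms unfolding poly_bounded_def by blast

lemma poly_bounded_mono: "poly_bounded E c \<Longrightarrow> (\<And>s. c' s \<le> c s) \<Longrightarrow> poly_bounded E c'"
  unfolding poly_bounded_def by (meson order_trans)

lemma poly_bounded_env_size_power: "poly_bounded E (\<lambda>s. env_size E s ^ d)"
  unfolding poly_bounded_def by blast

lemma poly_bounded_env_size [poly_bounded_intros]: "poly_bounded E (env_size E)"
  using poly_bounded_env_size_power[of E 1] by simp

lemma poly_bounded_const [poly_bounded_intros]: "poly_bounded E (\<lambda>_. c)"
proof (rule poly_bounded_mono[OF poly_bounded_env_size_power])
  fix s
  have "c \<le> 2 ^ c" by (simp add: less_imp_le)
  also have "\<dots> \<le> env_size E s ^ c" by (rule power_mono) (simp_all add: env_size_def)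
  finally show "c \<le> env_size E s ^ c" .
qed

lemma poly_bounded_mult [poly_bounded_intros]:
  assumes "poly_bounded E a" "poly_bounded E b"
  shows "poly_bounded E (\<lambda>s. a s * b s)"
proof -
  obtain d d' where "\<And>s. a s \<le> env_size E s ^ d" "\<And>s. b s \<le> env_size E s ^ d'"
    using assms by (metis poly_boundedE)
  then have "a s * b s \<le> env_size E s ^ (d + d')" for s
    unfolding power_add by (intro mult_mono) simp_all
  then show ?thesis by (rule poly_bounded_mono[OF poly_bounded_env_size_power])
qed

lemma poly_bounded_add [poly_bounded_intros]:
  assumes "poly_bounded E a" "poly_bounded E b"
  shows "poly_bounded E (\<lambda>s. a s + b s)"
proof -
  obtain d d' where degrees: "\<And>s. a s \<le> env_size E s ^ d" "\<And>s. b s \<le> env_size E s ^ d'"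
    using assms by (metis poly_boundedE)
  have "poly_bounded E (\<lambda>s. 2 * env_size E s ^ max d d')"
    by (intro poly_bounded_mult poly_bounded_const poly_bounded_env_size_power)
  moreover have "a s + b s \<le> 2 * env_size E s ^ max d d'" for s
  proof -
    have "env_size E s ^ d \<le> env_size E s ^ max d d'" "env_size E s ^ d' \<le> env_size E s ^ max d d'"
      by (simp_all add: power_increasing env_size_def)
    with degrees[of s] show ?thesis by linarith
  qed
  ultimately show ?thesis by (rule poly_bounded_mono)
qed

lemma poly_bounded_Suc [poly_bounded_intros]: "poly_bounded E a \<Longrightarrow> poly_bounded E (\<lambda>s. Suc (a s))"
  using poly_bounded_add[OF _ poly_bounded_const[of E 1]] by simp

lemma poly_bounded_power [poly_bounded_intros]: "poly_bounded E a \<Longrightarrow> poly_bounded E (\<lambda>s. a s ^ d)"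
proof (induction d)
  case 0
  show ?case using poly_bounded_const[of E 1] by simp
next
  case (Suc d)
  with poly_bounded_mult[of E a] show ?case by simp
qed

lemma poly_bounded_size_env:
  assumes "f \<in> set E"
  shows "poly_bounded E (\<lambda>s. size (f s))"
proof (rule poly_bounded_mono[OF poly_bounded_env_size])
  show "size (f s) \<le> env_size E s" for s
    using member_le_sum_list[of "size (f s)" "map (\<lambda>f. size (f s)) E"] assms
    by (simp add: env_size_def)
qed

subsection \<open>Evaluation with bounded cost\<close>

definition eval_within :: "program \<Rightarrow> data list \<Rightarrow> expr \<Rightarrow> data \<Rightarrow> nat \<Rightarrow> bool" where
  "eval_within P \<rho> e v c \<longleftrightarrow> (\<exists>n\<le>c. eval P \<rho> e v n)"

definition evals_within :: "program \<Rightarrow> data list \<Rightarrow> expr list \<Rightarrow> data list \<Rightarrow> nat \<Rightarrow> bool" where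
  "evals_within P \<rho> es vs c \<longleftrightarrow> (\<exists>n\<le>c. evals P \<rho> es vs n)"

lemma eval_within_mono: "eval_within P \<rho> e v c \<Longrightarrow> c \<le> c' \<Longrightarrow> eval_within P \<rho> e v c'"
  unfolding eval_within_def by (meson order_trans)

lemma eval_within_Var: "i < length \<rho> \<Longrightarrow> v = \<rho> ! i \<Longrightarrow> eval_within P \<rho> (Var i) v (Suc 0)"
  unfolding eval_within_def using eval_Var by fastforce

lemma eval_within_NilE: "eval_within P \<rho> NilE Dnil (Suc 0)"
  unfolding eval_within_def using eval_Nil by fastforce

lemma eval_within_ConsE:
  "eval_within P \<rho> e u m \<Longrightarrow> eval_within P \<rho> e' v n \<Longrightarrow>
   eval_within P \<rho> (ConsE e e') (Dcons u v) (Suc (m + n))"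
  unfolding eval_within_def by (metis eval_Cons add_mono Suc_eq_plus1 Suc_le_mono)

lemma eval_within_HdE: "eval_within P \<rho> e v n \<Longrightarrow> u = dhd v \<Longrightarrow> eval_within P \<rho> (HdE e) u (Suc n)"
  unfolding eval_within_def by (metis eval_Hd Suc_eq_plus1 Suc_le_mono)

lemma eval_within_TlE: "eval_within P \<rho> e v n \<Longrightarrow> u = dtl v \<Longrightarrow> eval_within P \<rho> (TlE e) u (Suc n)"
  unfolding eval_within_def by (metis eval_Tl Suc_eq_plus1 Suc_le_mono)

lemma eval_within_If_true:
  "eval_within P \<rho> b u m \<Longrightarrow> u \<noteq> Dnil \<Longrightarrow> eval_within P \<rho> e v n \<Longrightarrow>
   eval_within P \<rho> (IfE b e e') v (Suc (m + n))"
  unfolding eval_within_def by (metis eval_If_true add_mono Suc_eq_plus1 Suc_le_mono)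

lemma eval_within_If_false:
  "eval_within P \<rho> b Dnil m \<Longrightarrow> eval_within P \<rho> e' v n \<Longrightarrow>
   eval_within P \<rho> (IfE b e e') v (Suc (m + n))"
  unfolding eval_within_def by (metis eval_If_false add_mono Suc_eq_plus1 Suc_le_mono)

lemma eval_within_Call:
  "evals_within P \<rho> es us m \<Longrightarrow> f < length P \<Longrightarrow> eval_within P us (P ! f) v n \<Longrightarrow>
   eval_within P \<rho> (Call f es) v (Suc (m + n))"
  unfolding eval_within_def evals_within_def by (metis eval_Call add_mono Suc_eq_plus1 Suc_le_mono)

lemma evals_within_Nil: "evals_within P \<rho> [] [] 0"
  unfolding evals_within_def using evals_Nil by blast

lemma evals_within_Cons:
  "eval_within P \<rho> e v m \<Longrightarrow> evals_within P \<rho> es vs n \<Longrightarrow> evals_within P \<rho> (e # es) (v # vs) (m + n)"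
  unfolding eval_within_def evals_within_def by (meson evals_Cons add_mono)

lemma evals_within_Vars:
  assumes "a + n = length \<rho>"
  shows "evals_within P \<rho> (map Var [a..<length \<rho>]) (drop a \<rho>) n"
  using assms
proof (induction n arbitrary: a)
  case 0
  then show ?case by (simp add: evals_within_Nil)
next
  case (Suc n)
  then have "evals_within P \<rho> (Var a # map Var [Suc a..<length \<rho>]) (\<rho> ! a # drop (Suc a) \<rho>) (Suc 0 + n)"
    by (intro evals_within_Cons eval_within_Var) simp_all
  with Suc.prems show ?case
    by (simp add: upt_conv_Cons Cons_nth_drop_Suc)
qed

subsection \<open>Feasible functions\<close>

definition code_at :: "nat \<Rightarrow> program \<Rightarrow> program \<Rightarrow> bool" where
  "code_at l Q P \<longleftrightarrow> (\<exists>P\<^sub>1 P\<^sub>2. P = P\<^sub>1 @ Q @ P\<^sub>2 \<and> length P\<^sub>1 = l)"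

lemma code_at_appendD:
  assumes "code_at l (Q @ Q') P"
  shows "code_at l Q P" "code_at (l + length Q) Q' P"
proof -
  from assms obtain P\<^sub>1 P\<^sub>2 where split: "P = P\<^sub>1 @ (Q @ Q') @ P\<^sub>2" "length P\<^sub>1 = l"
    unfolding code_at_def by blast
  then have "P = P\<^sub>1 @ Q @ (Q' @ P\<^sub>2)" "P = (P\<^sub>1 @ Q) @ Q' @ P\<^sub>2" "length (P\<^sub>1 @ Q) = l + length Q"
    by simp_all
  with split(2) show "code_at l Q P" "code_at (l + length Q) Q' P"
    unfolding code_at_def by blast+
qed

lemma code_at_nth:
  assumes "code_at l Q P" "i < length Q"
  shows "l + i < length P" "P ! (l + i) = Q ! i"
  using assms unfolding code_at_def by (auto simp: nth_append)

text \<open>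
  A situation \<open>s\<close> determines both the environment \<open>E\<close> and the value \<open>f s\<close>.  The code of \<open>f\<close> may be
  placed at any position \<open>l\<close>, so that subprograms can be concatenated without renumbering calls.
\<close>

definition computes ::
  "('s \<Rightarrow> data) list \<Rightarrow> nat \<Rightarrow> program \<Rightarrow> expr \<Rightarrow> ('s \<Rightarrow> 'a :: encodable) \<Rightarrow> ('s \<Rightarrow> nat) \<Rightarrow> bool" where
  "computes E l Q e f c \<longleftrightarrow> (\<forall>P s. code_at l Q P \<longrightarrow>
     eval_within P (map (\<lambda>x. x s) E) e (encode (f s)) (c s))"

definition feasible :: "('s \<Rightarrow> data) list \<Rightarrow> ('s \<Rightarrow> 'a :: encodable) \<Rightarrow> bool" where
  "feasible E f \<longleftrightarrow> poly_bounded E (\<lambda>s. size (encode (f s))) \<and>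
     (\<forall>l. \<exists>Q e c. poly_bounded E c \<and> computes E l Q e f c)"

named_theorems feasible_intros

lemma computesI:
  "(\<And>P s. code_at l Q P \<Longrightarrow> eval_within P (map (\<lambda>x. x s) E) e (encode (f s)) (c s)) \<Longrightarrow>
   computes E l Q e f c"
  unfolding computes_def by blast

lemma computesD:
  "computes E l Q e f c \<Longrightarrow> code_at l Q P \<Longrightarrow>
   eval_within P (map (\<lambda>x. x s) E) e (encode (f s)) (c s)"
  unfolding computes_def by blast

lemma computes_append:
  "computes E l Q e f c \<Longrightarrow> computes E l (Q @ Q') e f c"
  "computes E (l + length Q) Q' e f c \<Longrightarrow> computes E l (Q @ Q') e f c"
  unfolding computes_def by (blast dest: code_at_appendD)+

lemma feasibleI:
  assumes "poly_bounded E (\<lambda>s. size (encode (f s)))"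
    and "\<And>l. \<exists>Q e c. poly_bounded E c \<and> computes E l Q e f c"
  shows "feasible E f"
  using assms unfolding feasible_def by blast

lemma feasible_size_bounded [poly_bounded_intros]:
  "feasible E f \<Longrightarrow> poly_bounded E (\<lambda>s. size (encode (f s)))"
  unfolding feasible_def by blast

lemma feasible_length_bounded [poly_bounded_intros]:
  "feasible E xs \<Longrightarrow> poly_bounded E (\<lambda>s. length (xs s))"
  by (rule poly_bounded_mono[OF feasible_size_bounded length_le_size_encode])

lemma feasibleE:
  assumes "feasible E f"
  obtains Q e c where "poly_bounded E c" "computes E l Q e f c"
  using assms unfolding feasible_def by blast

lemma feasible3E:
  assumes "feasible E\<^sub>1 f\<^sub>1" "feasible E\<^sub>2 f\<^sub>2" "feasible E\<^sub>3 f\<^sub>3"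
  obtains Q e\<^sub>1 c\<^sub>1 e\<^sub>2 c\<^sub>2 e\<^sub>3 c\<^sub>3 where
    "poly_bounded E\<^sub>1 c\<^sub>1" "poly_bounded E\<^sub>2 c\<^sub>2" "poly_bounded E\<^sub>3 c\<^sub>3"
    "computes E\<^sub>1 l Q e\<^sub>1 f\<^sub>1 c\<^sub>1" "computes E\<^sub>2 l Q e\<^sub>2 f\<^sub>2 c\<^sub>2" "computes E\<^sub>3 l Q e\<^sub>3 f\<^sub>3 c\<^sub>3"
proof -
  obtain Q\<^sub>1 e\<^sub>1 c\<^sub>1 where "poly_bounded E\<^sub>1 c\<^sub>1" "computes E\<^sub>1 l Q\<^sub>1 e\<^sub>1 f\<^sub>1 c\<^sub>1"
    using feasibleE[OF assms(1)] by blast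
  moreover obtain Q\<^sub>2 e\<^sub>2 c\<^sub>2 where "poly_bounded E\<^sub>2 c\<^sub>2"
    "computes E\<^sub>2 (l + length Q\<^sub>1) Q\<^sub>2 e\<^sub>2 f\<^sub>2 c\<^sub>2"
    using feasibleE[OF assms(2)] by blast
  moreover obtain Q\<^sub>3 e\<^sub>3 c\<^sub>3 where
    "poly_bounded E\<^sub>3 c\<^sub>3" "computes E\<^sub>3 (l + length (Q\<^sub>1 @ Q\<^sub>2)) Q\<^sub>3 e\<^sub>3 f\<^sub>3 c\<^sub>3"
    using feasibleE[OF assms(3)] by blast
  ultimately show thesis
    using that[of c\<^sub>1 c\<^sub>2 c\<^sub>3 "(Q\<^sub>1 @ Q\<^sub>2) @ Q\<^sub>3" e\<^sub>1 e\<^sub>2 e\<^sub>3] computes_append by metis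
qed

lemma feasible_expr3:
  assumes parts: "feasible E f\<^sub>1" "feasible E f\<^sub>2" "feasible E f\<^sub>3"
    and size: "poly_bounded E (\<lambda>s. size (encode (g s)))"
    and combine: "\<And>P \<rho> s e\<^sub>1 e\<^sub>2 e\<^sub>3 n\<^sub>1 n\<^sub>2 n\<^sub>3. eval_within P \<rho> e\<^sub>1 (encode (f\<^sub>1 s)) n\<^sub>1 \<Longrightarrow>
      eval_within P \<rho> e\<^sub>2 (encode (f\<^sub>2 s)) n\<^sub>2 \<Longrightarrow> eval_within P \<rho> e\<^sub>3 (encode (f\<^sub>3 s)) n\<^sub>3 \<Longrightarrow>
      eval_within P \<rho> (F e\<^sub>1 e\<^sub>2 e\<^sub>3) (encode (g s)) (Suc (n\<^sub>1 + n\<^sub>2 + n\<^sub>3))"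
  shows "feasible E g"
proof (rule feasibleI[OF size])
  fix l
  obtain Q e\<^sub>1 c\<^sub>1 e\<^sub>2 c\<^sub>2 e\<^sub>3 c\<^sub>3 where costs: "poly_bounded E c\<^sub>1" "poly_bounded E c\<^sub>2"
    "poly_bounded E c\<^sub>3"
    and code: "computes E l Q e\<^sub>1 f\<^sub>1 c\<^sub>1" "computes E l Q e\<^sub>2 f\<^sub>2 c\<^sub>2" "computes E l Q e\<^sub>3 f\<^sub>3 c\<^sub>3"
    using parts by (rule feasible3E)
  have "poly_bounded E (\<lambda>s. Suc (c\<^sub>1 s + c\<^sub>2 s + c\<^sub>3 s))" by (intro poly_bounded_intros costs)
  moreover have "computes E l Q (F e\<^sub>1 e\<^sub>2 e\<^sub>3) g (\<lambda>s. Suc (c\<^sub>1 s + c\<^sub>2 s + c\<^sub>3 s))"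
    by (intro computesI combine code[THEN computesD])
  ultimately show "\<exists>Q e c. poly_bounded E c \<and> computes E l Q e g c" by blast
qed

lemma feasible_expr2:
  assumes parts: "feasible E f\<^sub>1" "feasible E f\<^sub>2"
    and size: "poly_bounded E (\<lambda>s. size (encode (g s)))"
    and combine: "\<And>P \<rho> s e\<^sub>1 e\<^sub>2 n\<^sub>1 n\<^sub>2. eval_within P \<rho> e\<^sub>1 (encode (f\<^sub>1 s)) n\<^sub>1 \<Longrightarrow>
      eval_within P \<rho> e\<^sub>2 (encode (f\<^sub>2 s)) n\<^sub>2 \<Longrightarrow> eval_within P \<rho> (F e\<^sub>1 e\<^sub>2) (encode (g s)) (Suc (n\<^sub>1 + n\<^sub>2))"
  shows "feasible E g"
  using parts(1,2,2) size
proof (rule feasible_expr3[where F = "\<lambda>e\<^sub>1 e\<^sub>2 e\<^sub>3. F e\<^sub>1 e\<^sub>2"])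
qed (rule eval_within_mono[OF combine], assumption+, simp)

lemma feasible_expr1:
  assumes part: "feasible E f"
    and size: "\<And>s. size (encode (g s)) \<le> size (encode (f s))"
    and combine: "\<And>P \<rho> s e n. eval_within P \<rho> e (encode (f s)) n \<Longrightarrow>
        eval_within P \<rho> (F e) (encode (g s)) (Suc n)"
  shows "feasible E g"
  using part part poly_bounded_mono[OF feasible_size_bounded[OF part] size]
proof (rule feasible_expr2[where F = "\<lambda>e\<^sub>1 e\<^sub>2. F e\<^sub>1"])
qed (rule eval_within_mono[OF combine], assumption+, simp)

primrec quote :: "data \<Rightarrow> expr" where
  "quote Dnil = NilE"
| "quote (Dcons u v) = ConsE (quote u) (quote v)"

lemma eval_within_quote: "eval_within P \<rho> (quote v) v (2 * size v + 1)"
proof (induction v)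
  case Dnil
  then show ?case by (simp add: eval_within_NilE)
next
  case (Dcons u v)
  from eval_within_ConsE[OF this] show ?case by (simp add: algebra_simps)
qed

lemma feasible_const [feasible_intros]: "feasible E (\<lambda>_. a)"
proof (rule feasibleI)
  have "computes E l [] (quote (encode a)) (\<lambda>_. a) (\<lambda>_. 2 * size (encode a) + 1)" for l
    by (intro computesI eval_within_quote)
  then show "\<exists>Q e c. poly_bounded E c \<and> computes E l Q e (\<lambda>_. a) c" for l
    using poly_bounded_const by blast
qed (rule poly_bounded_const)

lemma feasible_env:
  assumes "(\<lambda>s. encode (f s)) \<in> set E"
  shows "feasible E f"
proof (rule feasibleI)
  from assms obtain i where "i < length E" "E ! i = (\<lambda>s. encode (f s))"
    by (auto simp: in_set_conv_nth)
  then have "computes E l [] (Var i) f (\<lambda>_. Suc 0)" for l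
    by (intro computesI eval_within_Var) simp_all
  then show "\<exists>Q e c. poly_bounded E c \<and> computes E l Q e f c" for l
    using poly_bounded_const by blast
qed (use poly_bounded_size_env[OF assms] in simp)

lemma feasible_Pair [feasible_intros]:
  assumes "feasible E a" "feasible E b"
  shows "feasible E (\<lambda>s. (a s, b s))"
  using assms by (rule feasible_expr2[where F = ConsE])
    (auto intro!: poly_bounded_intros assms dest: eval_within_ConsE)

lemma feasible_Cons [feasible_intros]:
  assumes "feasible E a" "feasible E b"
  shows "feasible E (\<lambda>s. a s # b s)"
  using assms by (rule feasible_expr2[where F = ConsE])
    (auto intro!: poly_bounded_intros assms dest: eval_within_ConsE)

lemma feasible_fst [feasible_intros]: "feasible E a \<Longrightarrow> feasible E (\<lambda>s. fst (a s))"
  by (rule feasible_expr1[where F = HdE]) (auto intro!: eval_within_HdE simp: encode_fst size_dhd_le)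

lemma feasible_snd [feasible_intros]: "feasible E a \<Longrightarrow> feasible E (\<lambda>s. snd (a s))"
  by (rule feasible_expr1[where F = TlE]) (auto intro!: eval_within_TlE simp: encode_snd size_dtl_le)

lemma feasible_tl [feasible_intros]: "feasible E a \<Longrightarrow> feasible E (\<lambda>s. tl (a s))"
  by (rule feasible_expr1[where F = TlE]) (auto intro!: eval_within_TlE simp: encode_tl size_dtl_le)

lemma feasible_case_prod [feasible_intros]:
  "feasible E (\<lambda>s. g s (fst (a s)) (snd (a s))) \<Longrightarrow> feasible E (\<lambda>s. case a s of (x, y) \<Rightarrow> g s x y)"
  by (simp add: case_prod_beta)

lemma feasible_if [feasible_intros]:
  assumes "feasible E b" "feasible E f" "feasible E g"
  shows "feasible E (\<lambda>s. if b s then f s else g s)"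
  using assms
proof (rule feasible_expr3[where F = IfE])
  have "poly_bounded E (\<lambda>s. size (encode (f s)) + size (encode (g s)))"
    by (intro poly_bounded_intros assms)
  then show "poly_bounded E (\<lambda>s. size (encode (if b s then f s else g s)))"
    by (rule poly_bounded_mono) simp
  fix P \<rho> s e\<^sub>1 e\<^sub>2 e\<^sub>3 n\<^sub>1 n\<^sub>2 n\<^sub>3
  assume "eval_within P \<rho> e\<^sub>1 (encode (b s)) n\<^sub>1" "eval_within P \<rho> e\<^sub>2 (encode (f s)) n\<^sub>2"
    "eval_within P \<rho> e\<^sub>3 (encode (g s)) n\<^sub>3"
  then show "eval_within P \<rho> (IfE e\<^sub>1 e\<^sub>2 e\<^sub>3) (encode (if b s then f s else g s)) (Suc (n\<^sub>1 + n\<^sub>2 + n\<^sub>3))"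
    by (cases "b s")
      (auto intro: eval_within_mono[OF eval_within_If_true] eval_within_mono[OF eval_within_If_false])
qed

lemma feasible_conj [feasible_intros]:
  assumes "feasible E a" "feasible E b"
  shows "feasible E (\<lambda>s. a s \<and> b s)"
proof -
  have "feasible E (\<lambda>s. if a s then b s else False)" by (intro feasible_intros assms)
  moreover have "(\<lambda>s. if a s then b s else False) = (\<lambda>s. a s \<and> b s)" by auto
  ultimately show ?thesis by simp
qed

lemma feasible_not [feasible_intros]:
  assumes "feasible E a"
  shows "feasible E (\<lambda>s. \<not> a s)"
proof -
  have "feasible E (\<lambda>s. if a s then False else True)" by (intro feasible_intros assms)
  moreover have "(\<lambda>s. if a s then False else True) = (\<lambda>s. \<not> a s)" by auto
  ultimately show ?thesis by simp
qed

definition equality_body :: "nat \<Rightarrow> expr" where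
  "equality_body f =
     IfE (Var 0)
       (IfE (Var 1)
         (IfE (Call f [HdE (Var 0), HdE (Var 1)]) (Call f [TlE (Var 0), TlE (Var 1)]) NilE)
         NilE)
       (IfE (Var 1) NilE (ConsE NilE NilE))"

lemma eval_within_equality_body_Dcons:
  assumes body: "f < length P" "P ! f = equality_body f"
    and eval_hd: "eval_within P [u, v] (equality_body f) (encode (u = v)) m"
    and eval_tl: "eval_within P [u', v'] (equality_body f) (encode (u' = v')) n"
  shows "eval_within P [Dcons u u', Dcons v v'] (equality_body f)
    (encode (Dcons u u' = Dcons v v')) (m + n + 20)"
proof -
  let ?\<rho> = "[Dcons u u', Dcons v v']"
  have vars: "eval_within P ?\<rho> (Var 0) (Dcons u u') (Suc 0)"
    "eval_within P ?\<rho> (Var 1) (Dcons v v') (Suc 0)"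
    by (auto intro: eval_within_Var)
  have "evals_within P ?\<rho> [HdE (Var 0), HdE (Var 1)] [u, v] (Suc (Suc 0) + (Suc (Suc 0) + 0))"
    by (intro evals_within_Cons evals_within_Nil eval_within_HdE[OF vars(1)] eval_within_HdE[OF vars(2)])
      simp_all
  from eval_within_Call[OF this body(1) eval_hd[folded body(2)]]
  have call_hd: "eval_within P ?\<rho> (Call f [HdE (Var 0), HdE (Var 1)]) (encode (u = v)) (m + 5)"
    by (rule eval_within_mono) simp
  have "evals_within P ?\<rho> [TlE (Var 0), TlE (Var 1)] [u', v'] (Suc (Suc 0) + (Suc (Suc 0) + 0))"
    by (intro evals_within_Cons evals_within_Nil eval_within_TlE[OF vars(1)] eval_within_TlE[OF vars(2)])
      simp_all
  from eval_within_Call[OF this body(1) eval_tl[folded body(2)]]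
  have call_tl: "eval_within P ?\<rho> (Call f [TlE (Var 0), TlE (Var 1)]) (encode (u' = v')) (n + 5)"
    by (rule eval_within_mono) simp
  have "eval_within P ?\<rho> (IfE (Call f [HdE (Var 0), HdE (Var 1)]) (Call f [TlE (Var 0), TlE (Var 1)]) NilE)
      (encode (Dcons u u' = Dcons v v')) (m + n + 12)"
  proof (cases "u = v")
    case True
    then have "encode (u = v) \<noteq> Dnil" "encode (Dcons u u' = Dcons v v') = encode (u' = v')"
      by simp_all
    with eval_within_If_true[OF call_hd _ call_tl, THEN eval_within_mono] show ?thesis by simp
  next
    case False
    with call_hd have "eval_within P ?\<rho> (Call f [HdE (Var 0), HdE (Var 1)]) Dnil (m + 5)" by simp
    from eval_within_If_false[OF this eval_within_NilE, THEN eval_within_mono] False show ?thesis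
      by simp
  qed
  from eval_within_If_true[OF vars(1) _ eval_within_If_true[OF vars(2) _ this]] show ?thesis
    unfolding equality_body_def by (rule eval_within_mono) simp_all
qed

lemma eval_within_equality_body:
  assumes "f < length P" "P ! f = equality_body f"
  shows "eval_within P [u, v] (equality_body f) (encode (u = v)) (30 * size u + 10)"
proof (induction u arbitrary: v)
  case Dnil
  have vars: "eval_within P [Dnil, v] (Var 0) Dnil (Suc 0)"
    "eval_within P [Dnil, v] (Var 1) v (Suc 0)"
    by (auto intro: eval_within_Var)
  have "eval_within P [Dnil, v] (IfE (Var 1) NilE (ConsE NilE NilE)) (encode (Dnil = v)) 5"
  proof (cases v)
    case Dnil
    with eval_within_If_false[OF _ eval_within_ConsE[OF eval_within_NilE eval_within_NilE],
        THEN eval_within_mono] vars(2)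
    show ?thesis by simp
  next
    case (Dcons v\<^sub>1 v\<^sub>2)
    with eval_within_If_true[OF vars(2) _ eval_within_NilE, THEN eval_within_mono] show ?thesis
      by simp
  qed
  from eval_within_If_false[OF vars(1) this] show ?case
    unfolding equality_body_def by (rule eval_within_mono) simp
next
  case (Dcons u u')
  show ?case
  proof (cases v)
    case Dnil
    have "eval_within P [Dcons u u', Dnil] (Var 0) (Dcons u u') (Suc 0)"
      "eval_within P [Dcons u u', Dnil] (Var 1) Dnil (Suc 0)"
      by (auto intro: eval_within_Var)
    from eval_within_If_true[OF this(1) _ eval_within_If_false[OF this(2) eval_within_NilE],
        THEN eval_within_mono] Dnil
    show ?thesis unfolding equality_body_def by simp
  next
    case (Dcons v\<^sub>1 v\<^sub>2)
    from eval_within_equality_body_Dcons[OF assms Dcons.IH, THEN eval_within_mono] Dcons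
    show ?thesis by simp
  qed
qed

lemma feasible_eq [feasible_intros]:
  assumes feasible_a: "feasible E a" and feasible_b: "feasible E b"
  shows "feasible E (\<lambda>s. a s = b s)"
proof (rule feasibleI)
  show "poly_bounded E (\<lambda>s. size (encode (a s = b s)))"
    by (rule poly_bounded_mono[OF poly_bounded_const size_encode_bool])
  fix l
  obtain Q e\<^sub>1 c\<^sub>1 e\<^sub>2 c\<^sub>2 where costs: "poly_bounded E c\<^sub>1" "poly_bounded E c\<^sub>2"
    and code: "computes E l Q e\<^sub>1 a c\<^sub>1" "computes E l Q e\<^sub>2 b c\<^sub>2"
    by (rule feasible3E[OF feasible_a feasible_b feasible_b])
  let ?f = "l + length Q"
  let ?c = "\<lambda>s. Suc (c\<^sub>1 s + (c\<^sub>2 s + 0) + (30 * size (encode (a s)) + 10))"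
  have "poly_bounded E ?c" by (intro poly_bounded_intros costs feasible_a)
  moreover have "computes E l (Q @ [equality_body ?f]) (Call ?f [e\<^sub>1, e\<^sub>2]) (\<lambda>s. a s = b s) ?c"
  proof (intro computesI eval_within_Call)
    fix P s assume placed: "code_at l (Q @ [equality_body ?f]) P"
    show "evals_within P (map (\<lambda>x. x s) E) [e\<^sub>1, e\<^sub>2] [encode (a s), encode (b s)] (c\<^sub>1 s + (c\<^sub>2 s + 0))"
      by (intro evals_within_Cons evals_within_Nil code[THEN computesD] code_at_appendD(1)[OF placed])
    have body: "?f < length P" "P ! ?f = equality_body ?f"
      using code_at_nth[OF placed, of "length Q"] by simp_all
    then show "?f < length P" and "eval_within P [encode (a s), encode (b s)] (P ! ?f) (encode (a s = b s))
        (30 * size (encode (a s)) + 10)"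
      using eval_within_equality_body[OF body, of "encode (a s)" "encode (b s)"] by simp_all
  qed
  ultimately show "\<exists>Q e c. poly_bounded E c \<and> computes E l Q e (\<lambda>s. a s = b s) c" by blast
qed

subsection \<open>Loops over lists\<close>

text \<open>
  The projections are constants of their own, and not \<open>fst\<close> and \<open>snd\<close>, so that at most one closure rule
  applies to each subterm of a loop body.
\<close>

type_synonym ('s, 'x, 'r) inner = "'s \<times> 'x \<times> 'r"

definition outer :: "('s, 'x, 'r) inner \<Rightarrow> 's" where "outer p = fst p"
definition elem :: "('s, 'x, 'r) inner \<Rightarrow> 'x" where "elem p = fst (snd p)"
definition accu :: "('s, 'x, 'r) inner \<Rightarrow> 'r" where "accu p = snd (snd p)"

lemma inner_simps [simp]: "outer (s, x, r) = s" "elem (s, x, r) = x" "accu (s, x, r) = r"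
  by (simp_all add: outer_def elem_def accu_def)

definition loop_env ::
  "('s \<Rightarrow> data) list \<Rightarrow> (('s, 'x :: encodable, 'r :: encodable) inner \<Rightarrow> data) list" where
  "loop_env E = (\<lambda>p. encode (elem p)) # (\<lambda>p. encode (accu p)) # map (\<lambda>x p. x (outer p)) E"

lemma map_loop_env:
  "map (\<lambda>x. x p) (loop_env E) = encode (elem p) # encode (accu p) # map (\<lambda>x. x (outer p)) E"
  by (simp add: loop_env_def)

lemma env_size_loop_env:
  "env_size (loop_env E) p = env_size E (outer p) + size (encode (elem p)) + size (encode (accu p))"
  by (simp add: env_size_def loop_env_def o_def)

lemma poly_bounded_outer:
  assumes "poly_bounded E c"
  shows "poly_bounded (loop_env E) (\<lambda>p. c (outer p))"
proof -
  obtain d where degree: "\<And>s. c s \<le> env_size E s ^ d" using assms by (rule poly_boundedE) blast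
  have "env_size E (outer p) ^ d \<le> env_size (loop_env E) p ^ d" for p
    by (rule power_mono) (simp_all add: env_size_loop_env)
  with degree have "c (outer p) \<le> env_size (loop_env E) p ^ d" for p by (rule order_trans)
  then show ?thesis by (rule poly_bounded_mono[OF poly_bounded_env_size_power])
qed

lemma poly_bounded_loopE:
  fixes c :: "('s, 'x :: encodable, 'r :: encodable) inner \<Rightarrow> nat"
  assumes "poly_bounded (loop_env E) c" "feasible E xs" "poly_bounded E b"
  obtains c' where "poly_bounded E c'"
    "\<And>s x r. x \<in> set (xs s) \<Longrightarrow> size (encode r) \<le> b s \<Longrightarrow> c (s, x, r) \<le> c' s"
proof -
  obtain d where degree: "\<And>p. c p \<le> env_size (loop_env E) p ^ d"
    using assms(1) by (rule poly_boundedE) blast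
  show thesis
  proof (rule that)
    show "poly_bounded E (\<lambda>s. (env_size E s + size (encode (xs s)) + b s) ^ d)"
      by (intro poly_bounded_intros assms)
    fix s x and r :: 'r assume "x \<in> set (xs s)" "size (encode r) \<le> b s"
    then have "env_size (loop_env E) (s, x, r) ^ d \<le>
        (env_size E s + size (encode (xs s)) + b s) ^ d"
      using size_encode_member[of x "xs s"] by (intro power_mono) (simp_all add: env_size_loop_env)
    with degree show "c (s, x, r) \<le> (env_size E s + size (encode (xs s)) + b s) ^ d"
      by (rule order_trans)
  qed
qed

lemma feasible_elem [feasible_intros]: "feasible (loop_env E) elem"
  by (rule feasible_env) (simp add: loop_env_def)

lemma feasible_accu [feasible_intros]: "feasible (loop_env E) accu"
  by (rule feasible_env) (simp add: loop_env_def)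

lemma feasible_outer:
  fixes E :: "('s \<Rightarrow> data) list"
  assumes "feasible E f"
  shows "feasible (loop_env E) (\<lambda>p :: ('s, 'x :: encodable, 'r :: encodable) inner. f (outer p))"
proof (rule feasibleI)
  show "poly_bounded (loop_env E) (\<lambda>p. size (encode (f (outer p))))"
    by (rule poly_bounded_outer[OF feasible_size_bounded[OF assms]])
  fix l
  obtain Q e c where cost: "poly_bounded E c" and code: "computes E l Q e f c"
    using assms by (rule feasibleE)
  let ?n = "length E" and ?f = "l + length Q"
  let ?c = "\<lambda>p :: ('s, 'x, 'r) inner. Suc (?n + c (outer p))"
  have "poly_bounded (loop_env E) ?c"
    by (intro poly_bounded_intros poly_bounded_outer cost)
  moreover have "computes (loop_env E) l (Q @ [e]) (Call ?f (map Var [2..<2 + ?n])) (\<lambda>p. f (outer p)) ?c"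
  proof (intro computesI eval_within_Call)
    fix P and p :: "('s, 'x, 'r) inner" assume placed: "code_at l (Q @ [e]) P"
    show "evals_within P (map (\<lambda>x. x p) (loop_env E)) (map Var [2..<2 + ?n])
        (map (\<lambda>x. x (outer p)) E) ?n"
      using evals_within_Vars[of 2 ?n "map (\<lambda>x. x p) (loop_env E)" P] by (simp add: map_loop_env)
    show "?f < length P" "eval_within P (map (\<lambda>x. x (outer p)) E) (P ! ?f) (encode (f (outer p))) (c (outer p))"
      using code_at_nth[OF placed, of "length Q"] computesD[OF code code_at_appendD(1)[OF placed]]
      by simp_all
  qed
  ultimately show "\<exists>Q e c. poly_bounded (loop_env E) c \<and>
      computes (loop_env E) l Q e (\<lambda>p :: ('s, 'x, 'r) inner. f (outer p)) c"
    by blast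
qed

text \<open>
  \<open>fold_body n f\<close> at position \<open>f\<close> folds a list in an environment of length \<open>n\<close>; the step is at
  position \<open>f + 1\<close> and the initial value at position \<open>f + 2\<close>.
\<close>

definition fold_body :: "nat \<Rightarrow> nat \<Rightarrow> expr" where
  "fold_body n f = IfE (Var 0)
     (Call (f + 1) (HdE (Var 0) # Call f (TlE (Var 0) # map Var [1..<1 + n]) # map Var [1..<1 + n]))
     (Call (f + 2) (map Var [1..<1 + n]))"

lemma eval_within_fold_body_Nil:
  assumes "f + 2 < length P" "eval_within P \<rho> (P ! (f + 2)) v c"
  shows "eval_within P (Dnil # \<rho>) (fold_body (length \<rho>) f) v (c + length \<rho> + 3)"
proof -
  have "evals_within P (Dnil # \<rho>) (map Var [1..<1 + length \<rho>]) \<rho> (length \<rho>)"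
    using evals_within_Vars[of 1 "length \<rho>" "Dnil # \<rho>"] by simp
  note eval_within_If_false[OF eval_within_Var eval_within_Call[OF this assms]]
  then show ?thesis unfolding fold_body_def by (rule eval_within_mono) simp_all
qed

lemma eval_within_fold_body_Cons:
  assumes body: "f + 2 < length P" "P ! f = fold_body (length \<rho>) f"
    and rest: "eval_within P (us # \<rho>) (fold_body (length \<rho>) f) w c"
    and step: "eval_within P (u # w # \<rho>) (P ! (f + 1)) v d"
  shows "eval_within P (Dcons u us # \<rho>) (fold_body (length \<rho>) f) v (c + d + 2 * length \<rho> + 8)"
proof -
  let ?\<rho> = "Dcons u us # \<rho>" and ?vars = "map Var [1..<1 + length \<rho>]"
  have var: "eval_within P ?\<rho> (Var 0) (Dcons u us) (Suc 0)"
    by (rule eval_within_Var) simp_all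
  have vars: "evals_within P ?\<rho> ?vars \<rho> (length \<rho>)"
    using evals_within_Vars[of 1 "length \<rho>" ?\<rho>] by simp
  have eval_hd: "eval_within P ?\<rho> (HdE (Var 0)) u 2"
    and eval_tl: "eval_within P ?\<rho> (TlE (Var 0)) us 2"
    using eval_within_HdE[OF var] eval_within_TlE[OF var] by (simp_all add: numeral_2_eq_2)
  have call: "eval_within P ?\<rho> (Call f (TlE (Var 0) # ?vars)) w (Suc (2 + length \<rho> + c))"
    using evals_within_Cons[OF eval_tl vars] body(1) rest[folded body(2)]
    by (intro eval_within_Call) simp_all
  have "eval_within P ?\<rho> (Call (f + 1) (HdE (Var 0) # Call f (TlE (Var 0) # ?vars) # ?vars)) v
      (Suc (2 + (Suc (2 + length \<rho> + c) + length \<rho>) + d))"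
    using evals_within_Cons[OF eval_hd evals_within_Cons[OF call vars]] body(1) step
    by (intro eval_within_Call) simp_all
  from eval_within_If_true[OF var _ this] show ?thesis
    unfolding fold_body_def by (rule eval_within_mono) simp_all
qed

lemma eval_within_fold_body:
  assumes body: "f + 2 < length P" "P ! f = fold_body (length \<rho>) f"
    and init: "eval_within P \<rho> (P ! (f + 2)) (encode a) c"
    and step: "\<And>x ys. suffix (x # ys) xs \<Longrightarrow>
      eval_within P (encode x # encode (foldr g ys a) # \<rho>) (P ! (f + 1)) (encode (foldr g (x # ys) a)) d"
  shows "suffix ys xs \<Longrightarrow> eval_within P (encode ys # \<rho>) (fold_body (length \<rho>) f) (encode (foldr g ys a))
    (length ys * (d + 2 * length \<rho> + 8) + (c + length \<rho> + 3))"
proof (induction ys)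
  case Nil
  from eval_within_fold_body_Nil[OF body(1) init] show ?case by simp
next
  case (Cons y ys)
  from eval_within_fold_body_Cons[OF body Cons.IH[OF suffix_ConsD[OF Cons.prems]] step[OF Cons.prems]]
  have "eval_within P (encode (y # ys) # \<rho>) (fold_body (length \<rho>) f) (encode (foldr g (y # ys) a))
      (length ys * (d + 2 * length \<rho> + 8) + (c + length \<rho> + 3) + d + 2 * length \<rho> + 8)" by simp
  then show ?case by (rule eval_within_mono) simp
qed

lemma computes_foldr:
  assumes list: "computes E l Q e\<^sub>1 xs c\<^sub>1" and init: "computes E l Q e\<^sub>2 a c\<^sub>2"
    and step: "computes (loop_env E) l Q e\<^sub>3 (\<lambda>p. g (outer p) (elem p) (accu p)) c\<^sub>3"
    and step_cost: "\<And>s x ys. suffix (x # ys) (xs s) \<Longrightarrow> c\<^sub>3 (s, x, foldr (g s) ys (a s)) \<le> d s"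
  defines "n \<equiv> length E" and "f \<equiv> l + length Q"
  shows "computes E l (Q @ [fold_body n f, e\<^sub>3, e\<^sub>2]) (Call f (e\<^sub>1 # map Var [0..<n]))
    (\<lambda>s. foldr (g s) (xs s) (a s))
    (\<lambda>s. Suc (c\<^sub>1 s + n + (length (xs s) * (d s + 2 * n + 8) + (c\<^sub>2 s + n + 3))))"
proof (intro computesI eval_within_Call)
  fix P s assume placed: "code_at l (Q @ [fold_body n f, e\<^sub>3, e\<^sub>2]) P"
  let ?\<rho> = "map (\<lambda>x. x s) E"
  note placed_Q = code_at_appendD(1)[OF placed]
  have layout: "f + 2 < length P" "P ! f = fold_body (length ?\<rho>) f" "P ! (f + 1) = e\<^sub>3"
    "P ! (f + 2) = e\<^sub>2"
    using code_at_nth[OF placed, of "length Q"] code_at_nth[OF placed, of "length Q + 1"]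
      code_at_nth[OF placed, of "length Q + 2"] by (simp_all add: nth_append f_def n_def)
  then show "f < length P" by simp
  show "evals_within P ?\<rho> (e\<^sub>1 # map Var [0..<n]) (encode (xs s) # ?\<rho>) (c\<^sub>1 s + n)"
    using evals_within_Vars[of 0 n ?\<rho>] computesD[OF list placed_Q]
    by (intro evals_within_Cons) (simp_all add: n_def)
  have "eval_within P (encode x # encode (foldr (g s) ys (a s)) # ?\<rho>) (P ! (f + 1))
      (encode (foldr (g s) (x # ys) (a s))) (d s)" if "suffix (x # ys) (xs s)" for x ys
    using computesD[OF step placed_Q, of "(s, x, foldr (g s) ys (a s))"] step_cost[OF that]
    unfolding layout(3) by (simp add: map_loop_env eval_within_mono)
  with eval_within_fold_body[OF layout(1,2), of "a s" "c\<^sub>2 s" "xs s" "g s" "d s" "xs s"]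
    computesD[OF init placed_Q] layout
  show "eval_within P (encode (xs s) # ?\<rho>) (P ! f) (encode (foldr (g s) (xs s) (a s)))
      (length (xs s) * (d s + 2 * n + 8) + (c\<^sub>2 s + n + 3))"
    by (simp add: n_def)
qed

lemma feasible_foldr:
  assumes feasible_xs: "feasible E xs" and feasible_a: "feasible E a"
    and feasible_g: "feasible (loop_env E) (\<lambda>p. g (outer p) (elem p) (accu p))"
    and bound: "poly_bounded E b"
      "\<And>s ys. suffix ys (xs s) \<Longrightarrow> size (encode (foldr (g s) ys (a s))) \<le> b s"
  shows "feasible E (\<lambda>s. foldr (g s) (xs s) (a s))"
proof (rule feasibleI)
  show "poly_bounded E (\<lambda>s. size (encode (foldr (g s) (xs s) (a s))))"
    by (rule poly_bounded_mono[OF bound(1)]) (simp add: bound(2))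
  fix l
  obtain Q e\<^sub>1 c\<^sub>1 e\<^sub>2 c\<^sub>2 e\<^sub>3 c\<^sub>3 where
    costs: "poly_bounded E c\<^sub>1" "poly_bounded E c\<^sub>2" "poly_bounded (loop_env E) c\<^sub>3"
    and code: "computes E l Q e\<^sub>1 xs c\<^sub>1" "computes E l Q e\<^sub>2 a c\<^sub>2"
      "computes (loop_env E) l Q e\<^sub>3 (\<lambda>p. g (outer p) (elem p) (accu p)) c\<^sub>3"
    using feasible_xs feasible_a feasible_g by (rule feasible3E)
  obtain d where step_cost: "poly_bounded E d"
    "\<And>s x r. x \<in> set (xs s) \<Longrightarrow> size (encode r) \<le> b s \<Longrightarrow> c\<^sub>3 (s, x, r) \<le> d s"
    using poly_bounded_loopE[OF costs(3) feasible_xs bound(1)] by blast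
  have "c\<^sub>3 (s, x, foldr (g s) ys (a s)) \<le> d s" if "suffix (x # ys) (xs s)" for s x ys
    using set_mono_suffix[OF that] by (intro step_cost bound(2) suffix_ConsD[OF that]) simp
  note computes_foldr[OF code this]
  moreover have "poly_bounded E (\<lambda>s. Suc (c\<^sub>1 s + length E +
      (length (xs s) * (d s + 2 * length E + 8) + (c\<^sub>2 s + length E + 3))))"
    by (intro poly_bounded_intros costs step_cost feasible_xs)
  ultimately show "\<exists>Q e c. poly_bounded E c \<and> computes E l Q e (\<lambda>s. foldr (g s) (xs s) (a s)) c"
    by blast
qed

lemma feasible_map [feasible_intros]:
  fixes g :: "'s \<Rightarrow> 'x :: encodable \<Rightarrow> 'y :: encodable"
  assumes feasible_xs: "feasible E xs"
    and feasible_g: "feasible (loop_env E) (\<lambda>p :: ('s, 'x, 'y list) inner. g (outer p) (elem p))"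
  shows "feasible E (\<lambda>s. map (g s) (xs s))"
proof -
  have foldr_eq: "foldr (\<lambda>x r. g s x # r) ys [] = map (g s) ys" for s ys
    by (induction ys) simp_all
  obtain c where bound: "poly_bounded E c"
    "\<And>s x r. x \<in> set (xs s) \<Longrightarrow> size (encode (r :: 'y list)) \<le> 0 \<Longrightarrow>
      size (encode (g (outer (s, x, r)) (elem (s, x, r)))) \<le> c s"
    using poly_bounded_loopE[OF feasible_size_bounded[OF feasible_g] feasible_xs
        poly_bounded_const[of E 0]] by blast
  have "feasible E (\<lambda>s. foldr (\<lambda>x r. g s x # r) (xs s) [])"
  proof (rule feasible_foldr)
    show "poly_bounded E (\<lambda>s. length (xs s) * (c s + 1))"
      by (intro poly_bounded_intros feasible_xs bound)
    fix s ys assume suffix: "suffix ys (xs s)"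
    have "size (encode (map (g s) ys)) \<le> length (map (g s) ys) * (c s + 1)"
      using set_mono_suffix[OF suffix] bound(2)[of _ _ "[]"] by (intro size_encode_list_le) auto
    also have "\<dots> \<le> length (xs s) * (c s + 1)"
      using suffix_length_le[OF suffix] by (intro mult_le_mono1) simp
    finally show "size (encode (foldr (\<lambda>x r. g s x # r) ys [])) \<le> length (xs s) * (c s + 1)"
      unfolding foldr_eq .
  qed (intro feasible_intros feasible_xs feasible_g)+
  then show ?thesis by (simp add: foldr_eq)
qed

lemma feasible_foldr_linear:
  assumes "feasible E xs" "feasible E a"
    and "feasible (loop_env E) (\<lambda>p. g (outer p) (elem p) (accu p))"
    and step: "\<And>s x r. size (encode (g s x r)) \<le> Suc (size (encode x) + size (encode r))"
  shows "feasible E (\<lambda>s. foldr (g s) (xs s) (a s))"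
  using assms(1-3)
proof (rule feasible_foldr)
  show "poly_bounded E (\<lambda>s. size (encode (xs s)) + size (encode (a s)))"
    by (intro poly_bounded_intros assms)
  have size_foldr: "size (encode (foldr (g s) ys (a s))) \<le> size (encode ys) + size (encode (a s))"
    for s ys
  proof (induction ys)
    case (Cons y ys)
    with step[of s y "foldr (g s) ys (a s)"] show ?case by simp
  qed simp
  show "size (encode (foldr (g s) ys (a s))) \<le> size (encode (xs s)) + size (encode (a s))"
    if "suffix ys (xs s)" for s ys
    using that size_foldr[of s ys] by (auto simp: suffix_def)
qed

lemma feasible_append [feasible_intros]:
  assumes "feasible E xs" "feasible E ys"
  shows "feasible E (\<lambda>s. xs s @ ys s)"
proof -
  have "feasible E (\<lambda>s. foldr (#) (xs s) (ys s))"
    by (rule feasible_foldr_linear) (intro feasible_intros assms | simp)+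
  moreover have "foldr (#) us vs = us @ vs" for us vs :: "'b list"
    by (induction us) simp_all
  ultimately show ?thesis by simp
qed

lemma feasible_concat [feasible_intros]:
  assumes "feasible E xss"
  shows "feasible E (\<lambda>s. concat (xss s))"
  unfolding concat_conv_foldr
  by (rule feasible_foldr_linear) (intro feasible_intros assms | simp)+

lemma feasible_filter [feasible_intros]:
  fixes g :: "'s \<Rightarrow> 'x :: encodable \<Rightarrow> bool"
  assumes "feasible E xs"
    and "feasible (loop_env E) (\<lambda>p :: ('s, 'x, 'x list) inner. g (outer p) (elem p))"
  shows "feasible E (\<lambda>s. filter (g s) (xs s))"
proof -
  have "feasible E (\<lambda>s. foldr (\<lambda>x r. if g s x then x # r else r) (xs s) [])"
    by (rule feasible_foldr_linear) (intro feasible_intros assms | simp)+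
  moreover have "foldr (\<lambda>x r. if g s x then x # r else r) ys [] = filter (g s) ys" for s ys
    by (induction ys) simp_all
  ultimately show ?thesis by simp
qed

lemma feasible_ball [feasible_intros]:
  fixes g :: "'s \<Rightarrow> 'x :: encodable \<Rightarrow> bool"
  assumes "feasible E xs"
    and "feasible (loop_env E) (\<lambda>p :: ('s, 'x, bool) inner. g (outer p) (elem p))"
  shows "feasible E (\<lambda>s. \<forall>x\<in>set (xs s). g s x)"
proof -
  have "feasible E (\<lambda>s. foldr (\<lambda>x r. g s x \<and> r) (xs s) True)"
    by (rule feasible_foldr_linear) (intro feasible_intros assms | simp add: encode_bool_def)+
  moreover have "foldr (\<lambda>x r. g s x \<and> r) ys True \<longleftrightarrow> (\<forall>x\<in>set ys. g s x)" for s ys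
    by (induction ys) simp_all
  ultimately show ?thesis by simp
qed

lemma feasible_member [feasible_intros]:
  assumes "feasible E a" "feasible E xs"
  shows "feasible E (\<lambda>s. a s \<in> set (xs s))"
proof -
  have "feasible E (\<lambda>s. \<not> (\<forall>x\<in>set (xs s). a s \<noteq> x))"
    by (intro feasible_intros assms feasible_outer)
  then show ?thesis by simp
qed

lemma feasible_take [feasible_intros]: "feasible E xs \<Longrightarrow> feasible E (\<lambda>s. take n (xs s))"
proof (induction n arbitrary: xs)
  case 0
  show ?case using feasible_const[of E "[]"] by simp
next
  case (Suc n)
  have foldr_eq: "foldr (\<lambda>x r. [x]) ys [] = take 1 ys" for ys :: "'b list"
    by (cases ys) simp_all
  have "feasible E (\<lambda>s. foldr (\<lambda>x r. [x]) (xs s) [])"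
    by (rule feasible_foldr_linear) (intro feasible_intros Suc.prems | simp)+
  then have "feasible E (\<lambda>s. take 1 (xs s) @ take n (tl (xs s)))"
    unfolding foldr_eq by (intro feasible_intros Suc)
  moreover have "take 1 ys @ take n (tl ys) = take (Suc n) ys" for ys :: "'b list"
    by (cases ys) simp_all
  ultimately show ?case by simp
qed

lemma feasible_replicate [feasible_intros]: "feasible E a \<Longrightarrow> feasible E (\<lambda>s. replicate n (a s))"
  by (induction n) (auto intro: feasible_intros)

lemma feasible_product [feasible_intros]:
  assumes "feasible E xs" "feasible E ys"
  shows "feasible E (\<lambda>s. List.product (xs s) (ys s))"
  unfolding product_concat_map by (intro feasible_intros assms feasible_outer)

section \<open>The algorithm is feasible\<close>

lemma feasible_lookup [feasible_intros]:
  assumes "feasible E d" "feasible E ps" "feasible E x"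
  shows "feasible E (\<lambda>s. lookup (d s) (ps s) (x s))"
proof -
  have "size (encode (snd p)) \<le> size (encode p)" for p :: "'c \<times> 'b"
    by (simp add: encode_snd size_dtl_le)
  then have "feasible E (\<lambda>s. foldr (\<lambda>p r. if fst p = x s then snd p else r) (ps s) (d s))"
    by (intro feasible_foldr_linear feasible_intros assms feasible_outer) (simp add: le_SucI trans_le_add1)
  moreover have "foldr (\<lambda>p r. if fst p = y then snd p else r) qs c = lookup c qs y"
    for c :: 'b and qs and y :: 'c
    by (induction qs) simp_all
  ultimately show ?thesis by simp
qed

subsection \<open>Bounds on the entries of a representation\<close>

definition pairs_bounded :: "nat \<Rightarrow> ('t :: encodable \<times> 't) list \<Rightarrow> bool" where
  "pairs_bounded b W \<longleftrightarrow> (\<forall>(t, u) \<in> set W. size (encode t) \<le> b \<and> size (encode u) \<le> b)"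

definition entry_bounded :: "nat \<Rightarrow> ('i :: encodable, 't :: encodable) entry \<Rightarrow> bool" where
  "entry_bounded b e \<longleftrightarrow> size (encode (fst e)) \<le> b \<and> length (snd e) \<le> b \<and> pairs_bounded b (snd e)"

lemma pairs_bounded_subset: "pairs_bounded b W \<Longrightarrow> set W' \<subseteq> set W \<Longrightarrow> pairs_bounded b W'"
  unfolding pairs_bounded_def by blast

lemma pairs_bounded_diagonal:
  "pairs_bounded b (diagonal ts) \<longleftrightarrow> (\<forall>t \<in> set ts. size (encode t) \<le> b)"
  by (auto simp: pairs_bounded_def)

lemma pairs_bounded_diagonal_fst: "pairs_bounded b W \<Longrightarrow> pairs_bounded b (diagonal (map fst W))"
  by (auto simp: pairs_bounded_diagonal) (auto simp: pairs_bounded_def)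

lemma entry_bounded_size_encode: "entry_bounded (size (encode e)) e"
proof -
  have "size (encode t) \<le> size (encode (snd e)) \<and> size (encode u) \<le> size (encode (snd e))"
    if "(t, u) \<in> set (snd e)" for t u
    using size_encode_member[OF that] by simp
  then show ?thesis
    using length_le_size_encode[of "snd e"]
    by (cases e) (fastforce simp: entry_bounded_def pairs_bounded_def)
qed

lemma entry_bounded_mono: "entry_bounded b e \<Longrightarrow> b \<le> c \<Longrightarrow> entry_bounded c e"
  unfolding entry_bounded_def pairs_bounded_def by fastforce

lemma entries_bounded_size_encode:
  assumes "size (encode es) \<le> b"
  shows "\<forall>e \<in> set es. entry_bounded b e"
proof
  fix e assume "e \<in> set es"
  from size_encode_member[OF this] assms have "size (encode e) \<le> b" by simp
  with entry_bounded_size_encode show "entry_bounded b e" by (rule entry_bounded_mono)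
qed

lemma size_encode_entry_le:
  assumes "entry_bounded b e"
  shows "size (encode e) \<le> b + b * (2 * b + 2) + 1"
proof -
  have "size (encode (t, u)) \<le> 2 * b + 1" if "(t, u) \<in> set (snd e)" for t u
    using that assms unfolding entry_bounded_def pairs_bounded_def by fastforce
  then have "size (encode p) \<le> 2 * b + 1" if "p \<in> set (snd e)" for p
    using that by (metis surj_pair)
  then have "size (encode (snd e)) \<le> length (snd e) * (2 * b + 1 + 1)"
    by (rule size_encode_list_le)
  also have "\<dots> \<le> b * (2 * b + 2)"
    using assms unfolding entry_bounded_def by (intro mult_le_mono) simp_all
  finally show ?thesis using assms unfolding entry_bounded_def by (cases e) simp
qed

lemma size_encode_entries_le:
  assumes "\<forall>e \<in> set es. entry_bounded b e"
  shows "size (encode es) \<le> length es * (b + b * (2 * b + 2) + 2)"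
proof -
  have "size (encode es) \<le> length es * (b + b * (2 * b + 2) + 1 + 1)"
    using assms by (intro size_encode_list_le size_encode_entry_le) simp
  then show ?thesis by simp
qed

lemma feasible_foldr_entries:
  fixes g :: "'s \<Rightarrow> 'x :: encodable \<Rightarrow> ('i :: encodable, 't :: encodable) entry list \<Rightarrow>
      ('i, 't) entry list"
  assumes "feasible E xs" "feasible E es"
    and "feasible (loop_env E) (\<lambda>p. g (outer p) (elem p) (accu p))"
    and bounds: "poly_bounded E b" "poly_bounded E n"
    and length: "\<And>s ys. suffix ys (xs s) \<Longrightarrow> length (foldr (g s) ys (es s)) \<le> n s"
    and bounded: "\<And>s ys. suffix ys (xs s) \<Longrightarrow> \<forall>e \<in> set (foldr (g s) ys (es s)). entry_bounded (b s) e"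
  shows "feasible E (\<lambda>s. foldr (g s) (xs s) (es s))"
  using assms(1-3)
proof (rule feasible_foldr)
  show "poly_bounded E (\<lambda>s. n s * (b s + b s * (2 * b s + 2) + 2))"
    by (intro poly_bounded_intros bounds)
  fix s ys assume suffix: "suffix ys (xs s)"
  then have "size (encode (foldr (g s) ys (es s))) \<le>
      length (foldr (g s) ys (es s)) * (b s + b s * (2 * b s + 2) + 2)"
    by (intro size_encode_entries_le bounded)
  also have "\<dots> \<le> n s * (b s + b s * (2 * b s + 2) + 2)"
    by (intro mult_le_mono1 length suffix)
  finally show "size (encode (foldr (g s) ys (es s))) \<le> n s * (b s + b s * (2 * b s + 2) + 2)" .
qed

lemma length_prune:
  fixes Q :: "'v list"
  shows "length (snd (prune val Q e)) \<le> (length Q)\<^sup>2"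
proof -
  have "length (concat (map (\<lambda>c. take 1 (W c)) cs)) \<le> length cs" for W and cs :: "('v \<times> 'v) list"
    by (induction cs) simp_all
  from this[of _ "List.product Q Q"] show ?thesis
    by (simp add: prune_def power2_eq_square)
qed

lemma length_swap_step: "length (swap_step val m Q i e es) = Suc (length es)"
  by (cases es) (simp_all add: swap_step_def transpose_entries_def)

lemma length_move_to_front: "length (move_to_front val m Q i es) = length es"
  by (induction es) (simp_all add: move_to_front_Nil move_to_front_Cons length_swap_step)

lemma length_constrain: "length (constrain val m Q A j es) = length es"
  by (simp add: constrain_def length_move_to_front)

context
  fixes val :: "'t :: encodable \<Rightarrow> 'i :: encodable \<Rightarrow> 'v" and m :: "'t \<Rightarrow> 't \<Rightarrow> 't \<Rightarrow> 't"
    and Q :: "'v list" and b :: nat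
  assumes size_m: "size (encode (m t u v)) \<le> b" and length_Q: "(length Q)\<^sup>2 \<le> b"
begin

lemma pairs_bounded_exchange:
  assumes "pairs_bounded b rs"
  shows "pairs_bounded b (exchange val m e rs)"
  using assms size_m unfolding pairs_bounded_def by (fastforce simp: mem_exchange)

lemma entry_bounded_prune:
  assumes "size (encode i) \<le> b" "pairs_bounded b W"
  shows "entry_bounded b (prune val Q (i, W))"
  using assms pairs_bounded_subset[OF assms(2)] set_prune_subset[of val Q "(i, W)"]
    order_trans[OF length_prune length_Q]
  by (simp add: entry_bounded_def)

lemma entry_bounded_transpose_entries:
  assumes "entry_bounded b e" "entry_bounded b f" "g \<in> set (transpose_entries val m Q e f)"
  shows "entry_bounded b g"
proof -
  have "pairs_bounded b (exchange_both val m e f (map fst W))" if "pairs_bounded b W" for W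
    unfolding exchange_both_def
    by (intro pairs_bounded_exchange pairs_bounded_diagonal_fst that)
  then have "pairs_bounded b (exchange_both val m e f (map fst (snd e)))"
    "pairs_bounded b (exchange_both val m e f (map fst (snd f)))"
    using assms(1,2) by (simp_all add: entry_bounded_def)
  moreover from pairs_bounded_subset[OF this(1)]
  have "pairs_bounded b (filter P (exchange_both val m e f (map fst (snd e))))" for P
    by simp
  moreover have "size (encode (fst e)) \<le> b" "size (encode (fst f)) \<le> b"
    using assms(1,2) by (simp_all add: entry_bounded_def)
  ultimately show ?thesis
    using assms(3) entry_bounded_prune unfolding transpose_entries_def by auto
qed

lemma entries_bounded_swap_step:
  assumes "entry_bounded b e" and bounded_es: "\<forall>f \<in> set es. entry_bounded b f"
  shows "\<forall>f \<in> set (swap_step val m Q i e es). entry_bounded b f"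
proof (cases "i \<in> set (map fst es)")
  case True
  then have "entry_at es i \<in> set es" unfolding entry_at_def by (intro lookup_mem) simp
  with assms have "entry_bounded b f" if "f \<in> set (transpose_entries val m Q e (entry_at es i))"
    for f
    using that entry_bounded_transpose_entries by blast
  moreover have "set (tl es) \<subseteq> set es" by (cases es) auto
  ultimately show ?thesis
    using bounded_es True unfolding swap_step_def by auto
next
  case False
  then show ?thesis using assms by (simp add: swap_step_def)
qed

lemma entries_bounded_move_to_front:
  "\<forall>e \<in> set es. entry_bounded b e \<Longrightarrow> \<forall>e \<in> set (move_to_front val m Q i es). entry_bounded b e"
proof (induction es)
  case (Cons e es)
  then have "\<forall>f \<in> set (move_to_front val m Q i es). entry_bounded b f" by simp
  with Cons.prems show ?case
    unfolding move_to_front_Cons by (intro entries_bounded_swap_step) simp_all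
qed (simp add: move_to_front_Nil)

lemma entries_bounded_constrain:
  assumes "\<forall>e \<in> set es. entry_bounded b e"
  shows "\<forall>e \<in> set (constrain val m Q A j es). entry_bounded b e"
proof -
  let ?es = "move_to_front val m Q j es"
  have "entry_bounded b (constrain_entry val m Q A j ?es e)" if "e \<in> set ?es" for e
  proof -
    let ?C = "candidates val m A j (fst e) (move_to_front val m Q (fst e) ?es)"
    have "size (encode c) \<le> b" if "c \<in> set ?C" for c
      using that size_m by (auto simp: candidates_def mem_exchange)
    then have "pairs_bounded b (exchange val m e (diagonal ?C))"
      by (intro pairs_bounded_exchange) (simp add: pairs_bounded_diagonal)
    from pairs_bounded_subset[OF this]
    have "pairs_bounded b (filter P (exchange val m e (diagonal ?C)))" for P by simp
    moreover have "entry_bounded b e" using entries_bounded_move_to_front[OF assms] that by blast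
    ultimately show ?thesis
      unfolding constrain_entry_def by (intro entry_bounded_prune) (simp_all add: entry_bounded_def)
  qed
  then show ?thesis by (simp add: constrain_def)
qed

end

subsection \<open>Assignments\<close>

text \<open>
  Assignments map vertices of \<open>G\<close> to vertices of \<open>H\<close>, with the junk value 0 outside the domain.  Their
  coordinates are the pairs of vertices of \<open>G\<close>, so that an arc of \<open>G\<close> constrains a single coordinate.
\<close>

type_synonym assignment = "(nat \<times> nat) list"

definition end_values :: "assignment \<Rightarrow> nat \<times> nat \<Rightarrow> nat \<times> nat" where
  "end_values t p = (lookup 0 t (fst p), lookup 0 t (snd p))"

definition maltsev_args :: "nat \<Rightarrow> 'a \<Rightarrow> 'a \<Rightarrow> 'a \<Rightarrow> 'a list" where
  "maltsev_args k a b c = a # replicate (k - 2) b @ [c]"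

definition table_value :: "(nat \<times> nat list \<times> nat) list \<Rightarrow> nat \<Rightarrow> nat list \<Rightarrow> nat" where
  "table_value T x as = lookup 0 (map (\<lambda>(y, bs, c). ((y, bs), c)) T) (x, as)"

definition table_maltsev ::
  "nat \<Rightarrow> nat list \<Rightarrow> (nat \<times> nat list \<times> nat) list \<Rightarrow> assignment \<Rightarrow> assignment \<Rightarrow> assignment \<Rightarrow>
      assignment" where
  "table_maltsev k V T t u v =
     map (\<lambda>x. (x, table_value T x (maltsev_args k (lookup 0 t x) (lookup 0 u x) (lookup 0 v x)))) V"

definition table_maltsev_bound :: "nat list \<Rightarrow> (nat \<times> nat list \<times> nat) list \<Rightarrow> nat" where
  "table_maltsev_bound V T = length V * (size (encode V) + size (encode T) + 2)"

lemma size_encode_table_maltsev: "size (encode (table_maltsev k V T t u v)) \<le>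
    table_maltsev_bound V T"
proof -
  have table: "size (encode (table_value T x as)) \<le> size (encode T)" for x as
    unfolding table_value_def by (induction T) (auto simp: case_prod_beta)
  have "size (encode p) \<le> size (encode V) + size (encode T) + 1"
    if mem: "p \<in> set (table_maltsev k V T t u v)" for p
  proof -
    obtain x as where "x \<in> set V" "p = (x, table_value T x as)"
      using mem unfolding table_maltsev_def set_map by blast
    with size_encode_member[of x V] table[of x as] show ?thesis by simp
  qed
  then have "size (encode (table_maltsev k V T t u v)) \<le>
      length (table_maltsev k V T t u v) * (size (encode V) + size (encode T) + 1 + 1)"
    by (rule size_encode_list_le)
  then show ?thesis
    unfolding table_maltsev_bound_def by (simp add: table_maltsev_def)
qed

lemma feasible_end_values [feasible_intros]:
  "feasible E t \<Longrightarrow> feasible E p \<Longrightarrow> feasible E (\<lambda>s. end_values (t s) (p s))"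
  unfolding end_values_def by (intro feasible_intros)

lemma feasible_table_maltsev [feasible_intros]:
  assumes "feasible E V" "feasible E T" "feasible E t" "feasible E u" "feasible E v"
  shows "feasible E (\<lambda>s. table_maltsev k (V s) (T s) (t s) (u s) (v s))"
  unfolding table_maltsev_def table_value_def maltsev_args_def
  by (intro feasible_intros assms feasible_outer)

lemma feasible_diagonal [feasible_intros]: "feasible E ts \<Longrightarrow> feasible E (\<lambda>s. diagonal (ts s))"
  unfolding diagonal_def by (intro feasible_intros)

lemma feasible_prune [feasible_intros]:
  assumes "feasible E e"
  shows "feasible E (\<lambda>s. prune end_values Q (e s))"
  unfolding prune_def by (intro feasible_intros assms feasible_outer)

lemma feasible_entry_at [feasible_intros]:
  assumes "feasible E es" "feasible E i"
  shows "feasible E (\<lambda>s. entry_at (es s) (i s))"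
  unfolding entry_at_def by (intro feasible_intros assms)

context
  fixes E :: "('s \<Rightarrow> data) list" and V :: "'s \<Rightarrow> nat list" and T :: "'s \<Rightarrow> (nat \<times> nat list \<times> nat) list"
  assumes feasible_V: "feasible E V" and feasible_T: "feasible E T"
begin

lemma feasible_exchange:
  assumes "feasible E e" "feasible E rs"
  shows "feasible E (\<lambda>s. exchange end_values (table_maltsev k (V s) (T s)) (e s) (rs s))"
  unfolding exchange_def by (intro feasible_intros feasible_V feasible_T assms feasible_outer)

lemma feasible_swap_step:
  assumes "feasible E i" "feasible E e" "feasible E es"
  shows "feasible E (\<lambda>s. swap_step end_values (table_maltsev k (V s) (T s)) Q (i s) (e s) (es s))"
  unfolding swap_step_def transpose_entries_def exchange_both_def
  by (intro feasible_intros feasible_exchange feasible_V feasible_T assms feasible_outer)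

lemma feasible_candidates:
  assumes "feasible E j" "feasible E i" "feasible E es"
  shows "feasible E (\<lambda>s. candidates end_values (table_maltsev k (V s) (T s)) A (j s) (i s) (es s))"
  unfolding candidates_def by (intro feasible_intros feasible_exchange feasible_V feasible_T assms feasible_outer)

end

definition input_bound :: "nat list \<Rightarrow> (nat \<times> nat list \<times> nat) list \<Rightarrow> nat \<Rightarrow>
    (nat \<times> nat, assignment) entry list \<Rightarrow> nat" where
  "input_bound V T q es = table_maltsev_bound V T + q\<^sup>2 + size (encode es)"

lemma poly_bounded_input_bound [poly_bounded_intros]:
  assumes "feasible E V" "feasible E T" "feasible E es"
  shows "poly_bounded E (\<lambda>s. input_bound (V s) (T s) q (es s))"
  unfolding input_bound_def table_maltsev_bound_def by (intro poly_bounded_intros assms)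

lemma feasible_move_to_front [feasible_intros]:
  assumes "feasible E V" "feasible E T" "feasible E i" "feasible E es"
  shows "feasible E (\<lambda>s. move_to_front end_values (table_maltsev k (V s) (T s)) Q (i s) (es s))"
  unfolding move_to_front_def
proof (rule feasible_foldr_entries)
  let ?b = "\<lambda>s. input_bound (V s) (T s) (length Q) (es s)"
  show "poly_bounded E ?b" "poly_bounded E (\<lambda>s. length (es s))"
    by (intro poly_bounded_intros assms)+
  fix s fs assume suffix: "suffix fs (es s)"
  let ?m = "table_maltsev k (V s) (T s)"
  show "length (foldr (swap_step end_values ?m Q (i s)) fs []) \<le> length (es s)"
    using suffix_length_le[OF suffix] length_move_to_front[of end_values ?m Q "i s" fs]
    by (simp add: move_to_front_def)
  have "size (encode (?m t u v)) \<le> ?b s" for t u v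
    using size_encode_table_maltsev[of k "V s" "T s" t u v] by (simp add: input_bound_def)
  moreover have "(length Q)\<^sup>2 \<le> ?b s" by (simp add: input_bound_def)
  moreover have "\<forall>e \<in> set fs. entry_bounded (?b s) e"
    using entries_bounded_size_encode[of "es s" "?b s"] set_mono_suffix[OF suffix]
    by (auto simp: input_bound_def)
  ultimately have "\<forall>e \<in> set (move_to_front end_values ?m Q (i s) fs). entry_bounded (?b s) e"
    by (rule entries_bounded_move_to_front)
  then show "\<forall>e \<in> set (foldr (swap_step end_values ?m Q (i s)) fs []). entry_bounded (?b s) e"
    by (simp add: move_to_front_def)
qed (intro feasible_intros feasible_swap_step assms feasible_outer)+

lemma feasible_constrain [feasible_intros]:
  assumes "feasible E V" "feasible E T" "feasible E j" "feasible E es"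
  shows "feasible E (\<lambda>s. constrain end_values (table_maltsev k (V s) (T s)) Q A (j s) (es s))"
  unfolding constrain_def constrain_entry_def
  by (intro feasible_intros feasible_exchange feasible_candidates assms feasible_outer)

lemma feasible_foldr_constrain [feasible_intros]:
  assumes "feasible E V" "feasible E T" "feasible E js" "feasible E es"
  shows "feasible E (\<lambda>s. foldr (constrain end_values (table_maltsev k (V s) (T s)) Q A) (js s) (es s))"
proof (rule feasible_foldr_entries)
  let ?b = "\<lambda>s. input_bound (V s) (T s) (length Q) (es s)"
  show "poly_bounded E ?b" "poly_bounded E (\<lambda>s. length (es s))"
    by (intro poly_bounded_intros assms)+
  fix s ks
  let ?m = "table_maltsev k (V s) (T s)"
  let ?fold = "\<lambda>js. foldr (constrain end_values ?m Q A) js (es s)"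
  show "length (?fold ks) \<le> length (es s)"
    by (induction ks) (simp_all add: length_constrain)
  have size_maltsev: "size (encode (?m t u v)) \<le> ?b s" for t u v
    using size_encode_table_maltsev[of k "V s" "T s" t u v] by (simp add: input_bound_def)
  have length_values: "(length Q)\<^sup>2 \<le> ?b s" by (simp add: input_bound_def)
  show "\<forall>e \<in> set (?fold ks). entry_bounded (?b s) e"
  proof (induction ks)
    case Nil
    show ?case by (rule entries_bounded_size_encode) (simp add: input_bound_def)
  next
    case (Cons j ks)
    with entries_bounded_constrain[OF size_maltsev length_values] show ?case by simp
  qed
qed (intro feasible_intros assms feasible_outer)+

definition values_of :: "(nat \<times> nat) list \<Rightarrow> nat \<Rightarrow> nat list" where
  "values_of L x = map snd (filter (\<lambda>p. fst p = x) L)"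

text \<open>The lists \<open>L\<close> also provide the values at the vertices that are not bound by \<open>ps\<close>.\<close>

definition complete_assignment :: "nat list \<Rightarrow> (nat \<times> nat) list \<Rightarrow> (nat \<times> nat) list \<Rightarrow>
    assignment" where
  "complete_assignment V L ps = map (\<lambda>x. (x, lookup 0 (ps @ L) x)) V"

definition vertex_entry :: "nat list \<Rightarrow> (nat \<times> nat) list \<Rightarrow> nat \<Rightarrow>
    (assignment \<times> assignment) list" where
  "vertex_entry V L x =
     map (\<lambda>(a, b). (complete_assignment V L [(x, a)], complete_assignment V L [(x, b)]))
       (List.product (values_of L x) (values_of L x))"

text \<open>
  Assignments that agree at \<open>(x, x)\<close> and \<open>(y, y)\<close> agree at \<open>(x, y)\<close>, so diagonal witnesses suffice there.
\<close>

definition pair_entry :: "nat list \<Rightarrow> (nat \<times> nat) list \<Rightarrow> nat \<times> nat \<Rightarrow>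
    (assignment \<times> assignment) list" where
  "pair_entry V L p = diagonal (map (\<lambda>(a, b). complete_assignment V L [(fst p, a), (snd p, b)])
     (List.product (values_of L (fst p)) (values_of L (snd p))))"

definition initial_entries :: "nat list \<Rightarrow> (nat \<times> nat) list \<Rightarrow>
    (nat \<times> nat, assignment) entry list" where
  "initial_entries V L = map (\<lambda>x. ((x, x), vertex_entry V L x)) V @
     map (\<lambda>p. (p, pair_entry V L p)) (filter (\<lambda>p. fst p \<noteq> snd p) (List.product V V))"

text \<open>With the junk value 0 included, every coordinate of an assignment has its value in this list.\<close>

definition pair_values :: "nat list \<Rightarrow> (nat \<times> nat) list" where
  "pair_values B = List.product (0 # B) (0 # B)"

definition decide ::
  "nat \<Rightarrow> nat list \<Rightarrow> (nat \<times> nat) list \<Rightarrow> nat list \<Rightarrow> (nat \<times> nat) list \<Rightarrow> (nat \<times> nat) list \<Rightarrow>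
   (nat \<times> nat list \<times> nat) list \<Rightarrow> bool" where
  "decide k B A\<^sub>H V A\<^sub>G L T \<longleftrightarrow> (\<forall>x \<in> set V. values_of L x \<noteq> []) \<and>
     (\<forall>e \<in> set (foldr (constrain end_values (table_maltsev k V T) (pair_values B) A\<^sub>H) A\<^sub>G
        (initial_entries V L)). snd e \<noteq> [])"

lemma feasible_complete_assignment [feasible_intros]:
  assumes "feasible E V" "feasible E L" "feasible E ps"
  shows "feasible E (\<lambda>s. complete_assignment (V s) (L s) (ps s))"
  unfolding complete_assignment_def by (intro feasible_intros assms feasible_outer)

lemma feasible_values_of [feasible_intros]:
  assumes "feasible E L" "feasible E x"
  shows "feasible E (\<lambda>s. values_of (L s) (x s))"
  unfolding values_of_def by (intro feasible_intros assms feasible_outer)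

lemma feasible_initial_entries [feasible_intros]:
  assumes "feasible E V" "feasible E L"
  shows "feasible E (\<lambda>s. initial_entries (V s) (L s))"
  unfolding initial_entries_def vertex_entry_def pair_entry_def
  by (intro feasible_intros assms feasible_outer)

lemma feasible_decide [feasible_intros]:
  assumes "feasible E V" "feasible E A" "feasible E L" "feasible E T"
  shows "feasible E (\<lambda>s. decide k B A\<^sub>H (V s) (A s) (L s) (T s))"
  unfolding decide_def by (intro feasible_intros assms feasible_outer)

section \<open>Correctness of the algorithm\<close>

lemma length_maltsev_args: "k \<ge> 2 \<Longrightarrow> length (maltsev_args k a b c) = k"
  by (simp add: maltsev_args_def)

lemma nth_maltsev_args:
  assumes "k \<ge> 2" "i < k"
  shows "maltsev_args k a b c ! i = (if i = 0 then a else if i = k - 1 then c else b)"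
  using assms by (auto simp: maltsev_args_def nth_append nth_Cons split: nat.split)

lemma maltsev_args_eq_list_update:
  assumes "k \<ge> 2"
  shows "maltsev_args k a b b = (replicate k b)[0 := a]"
    and "maltsev_args k b b c = (replicate k b)[k - 1 := c]"
  using assms by (auto intro!: nth_equalityI simp: length_maltsev_args nth_maltsev_args nth_list_update)

lemma maltsev_args_mem_tuples:
  "k \<ge> 2 \<Longrightarrow> a \<in> S \<Longrightarrow> b \<in> S \<Longrightarrow> c \<in> S \<Longrightarrow> maltsev_args k a b c \<in> tuples k S"
  by (auto simp: maltsev_args_def tuples_def)

locale encoded_instance =
  fixes G H :: "nat pair_pre_digraph" and L :: "nat \<Rightarrow> nat set" and h :: "nat \<Rightarrow> nat list \<Rightarrow> nat"
    and k :: nat and V B :: "nat list" and A\<^sub>G A\<^sub>H Ls :: "(nat \<times> nat) list"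
    and T :: "(nat \<times> nat list \<times> nat) list"
  assumes arity: "k \<ge> 2"
    and digraph: "pair_fin_digraph G"
    and lists: "list_assignment G H L"
    and minority: "minority_homomorphism k G H L h"
    and distinct_V: "distinct V"
    and set_V: "set V = pverts G" and set_B: "set B = pverts H"
    and set_A\<^sub>G: "set A\<^sub>G = parcs G" and set_A\<^sub>H: "set A\<^sub>H = parcs H"
    and set_Ls: "set Ls = (SIGMA x : pverts G. L x)"
    and set_T: "set T = {(x, as, h x as) | x as. x \<in> pverts G \<and> as \<in> tuples k (L x)}"
begin

definition list_assignments :: "assignment set" where
  "list_assignments = {t. map fst t = V \<and> (\<forall>x \<in> set V. lookup 0 t x \<in> L x)}"

abbreviation maltsev :: "assignment \<Rightarrow> assignment \<Rightarrow> assignment \<Rightarrow> assignment" where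
  "maltsev \<equiv> table_maltsev k V T"

lemma set_A\<^sub>G_subset: "set A\<^sub>G \<subseteq> set V \<times> set V"
proof -
  interpret pair_fin_digraph G by (rule digraph)
  show ?thesis using in_arcsD1 in_arcsD2 by (auto simp: set_A\<^sub>G set_V)
qed

lemma lookup_list_assignments: "t \<in> list_assignments \<Longrightarrow> x \<in> set V \<Longrightarrow> lookup 0 t x \<in> L x"
  by (simp add: list_assignments_def)

lemma lookup_list_assignments_absent: "t \<in> list_assignments \<Longrightarrow> x \<notin> set V \<Longrightarrow> lookup 0 t x = 0"
  by (rule lookup_absent) (auto simp: list_assignments_def simp flip: set_map)

lemma table_value_eq:
  assumes "x \<in> set V" "as \<in> tuples k (L x)"
  shows "table_value T x as = h x as"
  unfolding table_value_def
proof (rule lookup_unique)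
  have "(x, as, h x as) \<in> set T" using assms by (auto simp: set_T set_V)
  then show "((x, as), h x as) \<in> set (map (\<lambda>(y, bs, c). ((y, bs), c)) T)" by force
  show "c = h x as" if "((x, as), c) \<in> set (map (\<lambda>(y, bs, c). ((y, bs), c)) T)" for c
    using that by (auto simp: set_T)
qed

lemma args_mem_tuples:
  assumes "t \<in> list_assignments" "u \<in> list_assignments" "v \<in> list_assignments" "x \<in> set V"
  shows "maltsev_args k (lookup 0 t x) (lookup 0 u x) (lookup 0 v x) \<in> tuples k (L x)"
  using assms by (intro maltsev_args_mem_tuples arity lookup_list_assignments)

lemma lookup_maltsev:
  assumes "t \<in> list_assignments" "u \<in> list_assignments" "v \<in> list_assignments" "x \<in> set V"
  shows "lookup 0 (maltsev t u v) x = h x (maltsev_args k (lookup 0 t x) (lookup 0 u x) (lookup 0 v x))"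
  using assms by (simp add: table_maltsev_def lookup_map table_value_eq args_mem_tuples)

lemma maltsev_mem_list_assignments:
  assumes "t \<in> list_assignments" "u \<in> list_assignments" "v \<in> list_assignments"
  shows "maltsev t u v \<in> list_assignments"
proof -
  have "lookup 0 (maltsev t u v) x \<in> L x" if "x \<in> set V" for x
    using args_mem_tuples[OF assms that] minority that set_V unfolding lookup_maltsev[OF assms that]
    by (simp add: minority_homomorphism_def consistent_homomorphism_def)
  moreover have "map fst (maltsev t u v) = V" by (simp add: table_maltsev_def o_def)
  ultimately show ?thesis by (simp add: list_assignments_def)
qed

lemma lookup_maltsev_cancel:
  assumes "t \<in> list_assignments" "u \<in> list_assignments" "v \<in> list_assignments"
  shows "lookup 0 u x = lookup 0 v x \<Longrightarrow> lookup 0 (maltsev t u v) x = lookup 0 t x"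
    and "lookup 0 t x = lookup 0 u x \<Longrightarrow> lookup 0 (maltsev t u v) x = lookup 0 v x"
proof -
  have h_minority: "h x ((replicate k b)[i := a]) = a"
    if "x \<in> set V" "a \<in> L x" "b \<in> L x" "i < k" for a b i
    using minority that unfolding minority_homomorphism_def set_V by blast
  have absent: "lookup 0 t x = 0" "lookup 0 v x = 0" "lookup 0 (maltsev t u v) x = 0" if "x \<notin> set V"
    using that assms maltsev_mem_list_assignments[OF assms]
    by (simp_all add: lookup_list_assignments_absent)
  show "lookup 0 (maltsev t u v) x = lookup 0 t x" if "lookup 0 u x = lookup 0 v x"
    using that assms arity absent
    by (cases "x \<in> set V")
      (simp_all add: lookup_maltsev lookup_list_assignments h_minority maltsev_args_eq_list_update(1))
  show "lookup 0 (maltsev t u v) x = lookup 0 v x" if "lookup 0 t x = lookup 0 u x"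
    using that assms arity absent
    by (cases "x \<in> set V")
      (simp_all add: lookup_maltsev lookup_list_assignments h_minority maltsev_args_eq_list_update(2))
qed

lemma end_values_maltsev_mem_arcs:
  assumes "t \<in> list_assignments" "u \<in> list_assignments" "v \<in> list_assignments" "p \<in> set A\<^sub>G"
    and "end_values t p \<in> set A\<^sub>H" "end_values u p \<in> set A\<^sub>H" "end_values v p \<in> set A\<^sub>H"
  shows "end_values (maltsev t u v) p \<in> set A\<^sub>H"
proof -
  obtain x y where p_eq: "p = (x, y)" by (cases p)
  have ends: "x \<in> set V" "y \<in> set V" using assms(4) set_A\<^sub>G_subset p_eq by auto
  let ?args = "\<lambda>z. maltsev_args k (lookup 0 t z) (lookup 0 u z) (lookup 0 v z)"
  have "\<forall>i < k. (?args x ! i, ?args y ! i) \<in> parcs H"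
    using assms(5-7) arity by (simp add: p_eq end_values_def set_A\<^sub>H nth_maltsev_args)
  moreover have "(x, y) \<in> parcs G" using assms(4) p_eq set_A\<^sub>G by simp
  ultimately have "(h x (?args x), h y (?args y)) \<in> parcs H"
    using minority args_mem_tuples[OF assms(1-3) ends(1)] args_mem_tuples[OF assms(1-3) ends(2)]
    unfolding minority_homomorphism_def consistent_homomorphism_def by blast
  then show ?thesis
    using assms(1-3) ends by (simp add: p_eq end_values_def set_A\<^sub>H lookup_maltsev)
qed

lemma maltsev_relation_list_assignments:
  assumes "C \<subseteq> set A\<^sub>G"
  shows "maltsev_relation end_values maltsev (pair_values B)
    {t \<in> list_assignments. \<forall>p \<in> C. end_values t p \<in> set A\<^sub>H}"
proof
  fix t u v and p :: "nat \<times> nat"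
  assume "t \<in> {t \<in> list_assignments. \<forall>p \<in> C. end_values t p \<in> set A\<^sub>H}"
    "u \<in> {t \<in> list_assignments. \<forall>p \<in> C. end_values t p \<in> set A\<^sub>H}"
    "v \<in> {t \<in> list_assignments. \<forall>p \<in> C. end_values t p \<in> set A\<^sub>H}"
  then have assignments: "t \<in> list_assignments" "u \<in> list_assignments" "v \<in> list_assignments"
    and arcs: "\<forall>p \<in> C. end_values t p \<in> set A\<^sub>H" "\<forall>p \<in> C. end_values u p \<in> set A\<^sub>H"
      "\<forall>p \<in> C. end_values v p \<in> set A\<^sub>H"
    by auto
  show "maltsev t u v \<in> {t \<in> list_assignments. \<forall>p \<in> C. end_values t p \<in> set A\<^sub>H}"
    using maltsev_mem_list_assignments[OF assignments] end_values_maltsev_mem_arcs[OF assignments] arcs assms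
    by blast
  show "end_values u p = end_values v p \<Longrightarrow> end_values (maltsev t u v) p = end_values t p"
    "end_values t p = end_values u p \<Longrightarrow> end_values (maltsev t u v) p = end_values v p"
    using assignments by (simp_all add: end_values_def lookup_maltsev_cancel)
next
  fix t and p :: "nat \<times> nat"
  assume "t \<in> {t \<in> list_assignments. \<forall>p \<in> C. end_values t p \<in> set A\<^sub>H}"
  then have assignment: "t \<in> list_assignments" by simp
  have "lookup 0 t x \<in> set (0 # B)" for x
    using lookup_list_assignments[OF assignment, of x] lookup_list_assignments_absent[OF assignment, of x] lists
    by (cases "x \<in> set V") (auto simp: list_assignment_def set_V set_B)
  from SigmaI[OF this this] show "end_values t p \<in> set (pair_values B)"
    unfolding end_values_def pair_values_def set_product .
qed

lemma set_values_of: "x \<in> set V \<Longrightarrow> set (values_of Ls x) = L x"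
  by (force simp: values_of_def set_Ls set_V)

context
  assumes lists_nonempty: "\<And>x. x \<in> set V \<Longrightarrow> L x \<noteq> {}"
begin

lemma complete_assignment_mem:
  assumes "\<And>x a. (x, a) \<in> set ps \<Longrightarrow> x \<in> set V \<and> a \<in> L x"
  shows "complete_assignment V Ls ps \<in> list_assignments"
proof -
  have "lookup 0 (ps @ Ls) x \<in> L x" if "x \<in> set V" for x
  proof -
    from lists_nonempty[OF that] that obtain a where "(x, a) \<in> set Ls" by (auto simp: set_Ls set_V)
    then have "(x, lookup 0 (ps @ Ls) x) \<in> set (ps @ Ls)" by (intro lookup_mem) force
    with assms show ?thesis by (auto simp: set_Ls)
  qed
  then show ?thesis
    by (simp add: list_assignments_def complete_assignment_def lookup_map o_def)
qed

lemma witnesses_vertex_entry: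
  assumes vertex: "x \<in> set V" and avoids: "\<And>p. p \<in> S \<Longrightarrow> fst p \<noteq> x \<and> snd p \<noteq> x"
  shows "witnesses end_values list_assignments S (x, x) (vertex_entry V Ls x)"
proof (rule witnessesI)
  let ?c = "\<lambda>a. complete_assignment V Ls [(x, a)]"
  have agree: "agree_on end_values S (?c a) (?c b)" for a b
  proof -
    have "lookup 0 (?c a) y = lookup 0 (?c b) y" if "y \<noteq> x" for y
      using that by (simp add: complete_assignment_def lookup_map)
    with avoids show ?thesis by (simp add: agree_on_def end_values_def)
  qed
  show "p \<in> list_assignments \<and> q \<in> list_assignments \<and> agree_on end_values S p q"
    if pair: "(p, q) \<in> set (vertex_entry V Ls x)" for p q
  proof -
    from pair vertex obtain a b where "p = ?c a" "q = ?c b" "a \<in> L x" "b \<in> L x"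
      by (auto simp: vertex_entry_def set_values_of)
    with vertex agree show ?thesis by (auto intro: complete_assignment_mem)
  qed
  fix t u assume "t \<in> list_assignments" "u \<in> list_assignments"
  with vertex have "(?c (lookup 0 t x), ?c (lookup 0 u x)) \<in> set (vertex_entry V Ls x)"
    by (force simp: vertex_entry_def set_values_of lookup_list_assignments)
  moreover have "end_values (?c a) (x, x) = (a, a)" for a
    using vertex by (simp add: end_values_def complete_assignment_def lookup_map)
  ultimately show "\<exists>(p, q) \<in> set (vertex_entry V Ls x).
      end_values p (x, x) = end_values t (x, x) \<and> end_values q (x, x) = end_values u (x, x)"
    by (intro bexI[where x = "(?c (lookup 0 t x), ?c (lookup 0 u x))"]) (simp_all add: end_values_def)
qed

lemma witnesses_pair_entry:
  assumes ends: "fst p \<in> set V" "snd p \<in> set V" "fst p \<noteq> snd p"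
    and diagonal_subset: "(\<lambda>x. (x, x)) ` set V \<subseteq> S"
  shows "witnesses end_values list_assignments S p (pair_entry V Ls p)"
proof (rule witnessesI)
  let ?c = "\<lambda>a b. complete_assignment V Ls [(fst p, a), (snd p, b)]"
  show "r \<in> list_assignments \<and> s \<in> list_assignments \<and> agree_on end_values S r s"
    if "(r, s) \<in> set (pair_entry V Ls p)" for r s
  proof -
    from that ends obtain a b where "r = ?c a b" "s = ?c a b" "a \<in> L (fst p)" "b \<in> L (snd p)"
      by (auto simp: pair_entry_def set_values_of)
    with ends show ?thesis by (auto simp: agree_on_def intro: complete_assignment_mem)
  qed
  fix t u assume agreeing: "t \<in> list_assignments" "u \<in> list_assignments" "agree_on end_values S t u"
  let ?t = "?c (lookup 0 t (fst p)) (lookup 0 t (snd p))"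
  have "(?t, ?t) \<in> set (pair_entry V Ls p)"
    using ends agreeing(1) by (force simp: pair_entry_def set_values_of lookup_list_assignments)
  moreover have "end_values ?t p = end_values t p"
    using ends by (simp add: end_values_def complete_assignment_def lookup_map)
  moreover have "end_values t p = end_values u p"
  proof -
    have "end_values t (x, x) = end_values u (x, x)" if "x \<in> set V" for x
      using that diagonal_subset agreeing(3) by (auto simp: agree_on_def)
    with ends show ?thesis by (simp add: end_values_def)
  qed
  ultimately show "\<exists>(r, s) \<in> set (pair_entry V Ls p).
      end_values r p = end_values t p \<and> end_values s p = end_values u p"
    by force
qed

lemma represents_initial_entries: "represents end_values list_assignments {} (initial_entries V Ls)"
  unfolding initial_entries_def represents_append
proof
  show "represents end_values list_assignments {} (map (\<lambda>x. ((x, x), vertex_entry V Ls x)) V)"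
  proof (rule represents_mapI)
    fix us x vs assume split: "V = us @ x # vs"
    then have "x \<notin> set us" using distinct_V by simp
    with split show "witnesses end_values list_assignments ({} \<union> (\<lambda>x. (x, x)) ` set us) (x, x) (vertex_entry V Ls x)"
      by (intro witnesses_vertex_entry) auto
  qed
  show "represents end_values list_assignments ({} \<union> fst ` set (map (\<lambda>x. ((x, x), vertex_entry V Ls x)) V))
      (map (\<lambda>p. (p, pair_entry V Ls p)) (filter (\<lambda>p. fst p \<noteq> snd p) (List.product V V)))"
  proof (rule represents_mapI)
    fix us p vs assume "filter (\<lambda>p. fst p \<noteq> snd p) (List.product V V) = us @ p # vs"
    then have "p \<in> set (filter (\<lambda>p. fst p \<noteq> snd p) (List.product V V))" by simp
    then show "witnesses end_values list_assignments
        ({} \<union> fst ` set (map (\<lambda>x. ((x, x), vertex_entry V Ls x)) V) \<union> (\<lambda>p. p) ` set us) p (pair_entry V Ls p)"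
      by (intro witnesses_pair_entry) (auto simp: image_image)
  qed
qed

lemma coordinates_initial_entries:
  "distinct (map fst (initial_entries V Ls))" "set (map fst (initial_entries V Ls)) = set V \<times> set V"
proof -
  have coordinates: "map fst (initial_entries V Ls) =
      map (\<lambda>x. (x, x)) V @ filter (\<lambda>p. fst p \<noteq> snd p) (List.product V V)"
    by (simp add: initial_entries_def o_def)
  show "distinct (map fst (initial_entries V Ls))"
    unfolding coordinates using distinct_V by (auto simp: distinct_map distinct_product inj_on_def)
  show "set (map fst (initial_entries V Ls)) = set V \<times> set V"
    unfolding coordinates by auto
qed

lemma nonempty_entries_iff:
  "(\<forall>e \<in> set (foldr (constrain end_values maltsev (pair_values B) A\<^sub>H) A\<^sub>G (initial_entries V Ls)). snd e \<noteq> []) \<longleftrightarrow>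
     (\<exists>t \<in> list_assignments. \<forall>p \<in> set A\<^sub>G. end_values t p \<in> set A\<^sub>H)"
proof -
  let ?es = "foldr (constrain end_values maltsev (pair_values B) A\<^sub>H) A\<^sub>G (initial_entries V Ls)"
  let ?R = "{t \<in> list_assignments. \<forall>p \<in> set A\<^sub>G. end_values t p \<in> set A\<^sub>H}"
  have "represents end_values ?R {} ?es \<and> distinct (map fst ?es) \<and>
      set (map fst ?es) = set (map fst (initial_entries V Ls))"
    by (intro represents_foldr_constrain maltsev_relation_list_assignments represents_initial_entries)
      (use coordinates_initial_entries set_A\<^sub>G_subset in simp_all)
  then have represented: "represents end_values ?R {} ?es" "set (map fst ?es) = set V \<times> set V"
    unfolding coordinates_initial_entries(2) by blast+
  have "(\<forall>e \<in> set ?es. snd e \<noteq> []) \<longleftrightarrow> ?R \<noteq> {}"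
  proof (cases "?es = []")
    case True
    with represented(2) have "set V \<times> set V = {}" by simp
    then have "V = []" by simp
    then have "[] \<in> ?R"
      unfolding list_assignments_def using set_A\<^sub>G_subset by simp
    with True show ?thesis by auto
  next
    case False
    then have "hd ?es \<in> set ?es" by simp
    with represents_empty_iff[OF represented(1)] show ?thesis by blast
  qed
  then show ?thesis by blast
qed

end

lemma list_homomorphism_iff:
  "(\<exists>g. list_homomorphism G H L g) \<longleftrightarrow> (\<exists>t \<in> list_assignments. \<forall>p \<in> set A\<^sub>G. end_values t p \<in> set A\<^sub>H)"
proof
  assume "\<exists>g. list_homomorphism G H L g"
  then obtain g where hom: "list_homomorphism G H L g" ..
  let ?t = "map (\<lambda>x. (x, g x)) V"
  have "?t \<in> list_assignments"
    using hom by (simp add: list_assignments_def list_homomorphism_def set_V lookup_map o_def)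
  moreover have "end_values ?t (x, y) \<in> set A\<^sub>H" if "(x, y) \<in> set A\<^sub>G" for x y
  proof -
    have "x \<in> set V" "y \<in> set V" using that set_A\<^sub>G_subset by auto
    with that hom show ?thesis
      by (simp add: end_values_def list_homomorphism_def lookup_map set_A\<^sub>G set_A\<^sub>H)
  qed
  ultimately show "\<exists>t \<in> list_assignments. \<forall>p \<in> set A\<^sub>G. end_values t p \<in> set A\<^sub>H" by fast
next
  assume "\<exists>t \<in> list_assignments. \<forall>p \<in> set A\<^sub>G. end_values t p \<in> set A\<^sub>H"
  then obtain t where "t \<in> list_assignments" "\<forall>p \<in> set A\<^sub>G. end_values t p \<in> set A\<^sub>H" ..
  then have "list_homomorphism G H L (lookup 0 t)"
    by (auto simp: list_homomorphism_def list_assignments_def end_values_def set_V set_A\<^sub>G set_A\<^sub>H)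
  then show "\<exists>g. list_homomorphism G H L g" by blast
qed

lemma decide_iff: "decide k B A\<^sub>H V A\<^sub>G Ls T \<longleftrightarrow> (\<exists>g. list_homomorphism G H L g)"
proof (cases "\<forall>x \<in> set V. L x \<noteq> {}")
  case True
  then have "\<forall>x \<in> set V. values_of Ls x \<noteq> []" by (metis set_empty set_values_of)
  with True show ?thesis
    unfolding decide_def list_homomorphism_iff by (simp add: nonempty_entries_iff)
next
  case False
  then obtain x where "x \<in> set V" "L x = {}" by blast
  then have "values_of Ls x = []" by (metis set_empty set_values_of)
  with \<open>x \<in> set V\<close> \<open>L x = {}\<close> show ?thesis
    unfolding decide_def list_homomorphism_def set_V by blast
qed

end

lemma poly_time_decidable_if_feasible:
  fixes f :: "'s :: encodable \<Rightarrow> bool"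
  assumes feasible_f: "feasible [encode] f"
    and encodes: "\<And>i t. promise i \<Longrightarrow> encodes i t \<Longrightarrow> \<exists>s. t = encode s \<and> (f s \<longleftrightarrow> yes i)"
  shows "poly_time_decidable promise encodes yes"
proof -
  obtain Q e c where cost: "poly_bounded [encode :: 's \<Rightarrow> data] c"
    and code: "computes [encode] 1 Q e f c"
    using feasible_f by (rule feasibleE)
  obtain d where "\<And>s. c s \<le> env_size [encode] s ^ d"
    using cost by (rule poly_boundedE) blast
  then have degree: "c s \<le> (2 + size (encode s)) ^ d" for s
    by (simp add: env_size_def)
  let ?q = "[:3 :: nat:] + [:2, 1:] ^ d"
  have "\<exists>out n. runs (e # Q) t out n \<and> n \<le> poly ?q (size t) \<and> (out \<noteq> Dnil \<longleftrightarrow> yes i)"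
    if "promise i" "encodes i t" for i t
  proof -
    from encodes[OF that] obtain s where input: "t = encode s" "f s \<longleftrightarrow> yes i" by blast
    have "code_at 1 Q (e # Q)"
      unfolding code_at_def by (intro exI[of _ "[e]"] exI[of _ "[]"]) simp
    from computesD[OF code this, of s]
    have "eval_within (e # Q) [t] (Call 0 [Var 0]) (encode (f s)) (Suc (Suc 0 + 0 + c s))"
      using input(1) by (intro eval_within_Call[OF evals_within_Cons[OF eval_within_Var evals_within_Nil]]) simp_all
    then obtain n where run: "runs (e # Q) t (encode (f s)) n" "n \<le> Suc (Suc (c s))"
      unfolding runs_def eval_within_def by auto
    from run(2) degree[of s] input(1) have "n \<le> poly ?q (size t)" by (simp add: poly_power)
    moreover have "encode (f s) \<noteq> Dnil \<longleftrightarrow> yes i" using input(2) by (cases "f s") simp_all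
    ultimately show ?thesis using run(1) by blast
  qed
  then show ?thesis unfolding poly_time_decidable_def by blast
qed

lemma encoded_instanceE:
  assumes "instance_encoding k (G, L, h) t" "k \<ge> 2"
    "pair_fin_digraph G" "list_assignment G H L" "minority_homomorphism k G H L h"
    "set B = pverts H" "set A\<^sub>H = parcs H"
  obtains V A\<^sub>G Ls T where "t = encode (V, A\<^sub>G, Ls, T)"
    "encoded_instance G H L h k V B A\<^sub>G A\<^sub>H Ls T"
proof -
  have codes: "nat_code = encode" "list_code encode = encode" "pair_code encode encode = encode"
    by (simp_all add: fun_eq_iff encode_nat_def encode_list_def encode_prod_def)
  obtain V A\<^sub>G Ls T where "t = encode (V, A\<^sub>G, Ls, T)" "distinct V" "set V = pverts G"
    "set A\<^sub>G = parcs G"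
    "set Ls = (SIGMA x : pverts G. L x)"
    "set T = {(x, as, h x as) | x as. x \<in> pverts G \<and> as \<in> tuples k (L x)}"
    using assms(1) unfolding instance_encoding_def set_encoding_def prod.case codes by auto
  with assms(2-) that show thesis by (simp add: encoded_instance_def)
qed

theorem theorem2:
  fixes H :: "nat pair_pre_digraph" and k :: nat
  assumes "pair_fin_digraph H" and "k \<ge> 2"
  shows "poly_time_decidable
    (\<lambda>(G, L, h). pair_fin_digraph G \<and> list_assignment G H L \<and> minority_homomorphism k G H L h)
    (instance_encoding k)
    (\<lambda>(G, L, h). \<exists>g. list_homomorphism G H L g)"
proof -
  have "finite (pverts H)" "finite (parcs H)"
    using assms(1) by (simp_all add: pair_fin_digraph_def pair_fin_digraph_axioms_def)
  then obtain B A\<^sub>H where lists_H: "set B = pverts H" "set A\<^sub>H = parcs H"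
    by (metis finite_list)
  let ?decide = "\<lambda>(V, A\<^sub>G, Ls, T). decide k B A\<^sub>H V A\<^sub>G Ls T"
  have feasible: "feasible [encode] ?decide"
    by (intro feasible_intros feasible_env) simp_all
  have decides: "\<exists>s. t = encode s \<and> (?decide s \<longleftrightarrow> (\<exists>g. list_homomorphism G H L g))"
    if promise: "pair_fin_digraph G" "list_assignment G H L" "minority_homomorphism k G H L h"
      and encoding: "instance_encoding k (G, L, h) t" for G L h t
  proof -
    obtain V A\<^sub>G Ls T where "t = encode (V, A\<^sub>G, Ls, T)"
      "encoded_instance G H L h k V B A\<^sub>G A\<^sub>H Ls T"
      using encoding assms(2) promise lists_H by (rule encoded_instanceE)
    then show ?thesis
      by (intro exI[of _ "(V, A\<^sub>G, Ls, T)"]) (simp add: encoded_instance.decide_iff)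
  qed
  show ?thesis
    by (rule poly_time_decidable_if_feasible[OF feasible])
      (clarsimp simp only: prod.case, rule decides)
qed

end
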